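(* Let $L$ be a real locally convex topological vector space with topological dual $L^*$, let $r:L\to(0,+\infty]$ be a logarithmically convex and lower semicontinuous functional, and put $\lambda(\varphi)=\ln r(\varphi)$ for $\varphi\in L$ (with $\ln(+\infty)=+\infty$). Assume that the set $\mathcal{D}_\lambda=\{\varphi\in L:\ \lambda(\varphi)<0\}$ is nonempty. Define $\widehat{\lambda}:l_\infty\times L\to\mathbb{R}\cup\{+\infty\}$ by $$\widehat{\lambda}(\mathbf{c},\varphi)=\begin{cases}\ln\sum_{n=0}^\infty e^{c_n+n\lambda(\varphi)} & \text{if } (\mathbf{c},\varphi)\in l_\infty\times\mathcal{D}_\lambda,\\ +\infty & \text{otherwise,}\end{cases}$$ and $\widehat{\tau}:l_1\times L^*\to\mathbb{R}\cup\{+\infty\}$ by $$\widehat{\tau}(\mathbf{t},\bar{\mu})=\begin{cases}\Big(\sum_{n=0}^\infty nt_n\Big)\lambda^*\Big(\dfrac{\bar{\mu}}{\sum_{n=0}^\infty nt_n}\Big)+\sum_{n=0}^\infty t_n\ln t_n & \text{if } (\mathbf{t},\bar{\mu})\in D_{\widehat{\tau}},\\ +\infty & \text{otherwise,}\end{cases}$$ where $$D_{\widehat{\tau}}=\Big\{(\mathbf{t},\bar{\mu})\in l_1\times L^*:\ \mathbf{t}\in\widetilde{S}\setminus\{e_0\}\ \text{ and }\ \frac{\bar{\mu}}{\sum_{n=0}^\infty nt_n}\in D(\lambda^* )\Big\}.$$ Then the convex conjugate $\widehat{\lambda}^*$ of $\widehat{\lambda}$, as a functional on $l_1\times L^*$,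 is the lower semicontinuous regularization of $\widehat{\tau}$.
   Context: Sequences $\mathbf{c}=(c_n)_{n=0}^\infty$ and $\mathbf{t}=(t_n)_{n=0}^\infty$ are real and indexed by $n\ge 0$. Convention: $0\ln 0=0$. Logarithmically convex means that $\ln r$ is convex. $\widetilde{S}=\{\mathbf{t}=(t_n)_{n=0}^\infty:\ t_n\ge 0,\ \sum_{n=0}^\infty t_n=1,\ \sum_{n=0}^\infty n t_n<\infty\}\subset l_1$ and $e_0=(1,0,0,\dots)$. (For $\mathbf{t}\in\widetilde{S}$ the series $\sum_n t_n\ln t_n$ converges to a finite value, and $\sum_n nt_n>0$ if $\mathbf{t}\ne e_0$.) The convex conjugate of $\lambda$ is $\lambda^*(\mu)=\sup_{\varphi\in L}\{\langle\mu,\varphi\rangle-\lambda(\varphi)\}$ for $\mu\in L^*$, and $D(\lambda^* )=\{\mu\in L^*:\lambda^*(\mu)<+\infty\}$ is its effective domain. The spaces $l_1\times L^*$ and $l_\infty\times L$ are paired by $\sum_{n=0}^\infty c_nt_n+\langle\bar{\mu},\varphi\rangle$, and $$\widehat{\lambda}^*(\mathbf{t},\bar{\mu})=\sup_{(\mathbf{c},\varphi)\in l_\infty\times L}\Big\{\sum_{n=0}^\infty c_nt_n+\langle\bar{\mu},\varphi\rangle-\widehat{\lambda}(\mathbf{c},\varphi)\Big\},\qquad(\mathbf{t},\bar{\mu})\in l_1\times L^*.$$ The lower semicontinuous regularization of a functional is the greatest lower semicontinuous functional pointwise less than or equal to it; here $l_1\times L^*$ carries the product of the norm topology of $l_1$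 and the weak-$*$ topology $\sigma(L^*,L)$ of $L^*$. *)

theory Defs
  imports "HOL-Analysis.Analysis"
begin

text \<open>Real locally convex topological vector spaces; the Hausdorff property is not required.\<close>

class real_lctvs = real_vector + topological_ab_group_add +
  assumes tendsto_scaleR_Pair: "LIM x (nhds a \<times>\<^sub>F nhds b). fst x *\<^sub>R snd x :> nhds (a *\<^sub>R b)"
  assumes locally_convex:
    "open U \<Longrightarrow> 0 \<in> U \<Longrightarrow> \<exists>V. open V \<and> 0 \<in> V \<and> V \<subseteq> U \<and>
       (\<forall>x\<in>V. \<forall>y\<in>V. \<forall>u\<ge>0. \<forall>v\<ge>0. u + v = 1 \<longrightarrow> u *\<^sub>R x + v *\<^sub>R y \<in> V)"

lemma ex_open_convex:
  fixes U :: "'a::real_lctvs set"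
  assumes "open U" "0 \<in> U"
  shows "\<exists>V. open V \<and> 0 \<in> V \<and> V \<subseteq> U \<and> convex V"
  using locally_convex[OF assms] unfolding convex_def .

instance real_normed_vector < real_lctvs
proof
  fix a :: real and b :: 'a
  show "LIM x (nhds a \<times>\<^sub>F nhds b). fst x *\<^sub>R snd x :> nhds (a *\<^sub>R b)"
    unfolding nhds_prod[symmetric]
    using tendsto_scaleR[OF tendsto_fst[OF filterlim_ident] tendsto_snd[OF filterlim_ident]]
    by fastforce
next
  fix U :: "'a set" assume "open U" "0 \<in> U"
  then obtain e where "e > 0" "ball 0 e \<subseteq> U"
    using open_contains_ball by blast
  then show "\<exists>V. open V \<and> 0 \<in> V \<and> V \<subseteq> U \<and>
      (\<forall>x\<in>V. \<forall>y\<in>V. \<forall>u\<ge>0. \<forall>v\<ge>0. u + v = 1 \<longrightarrow> u *\<^sub>R x + v *\<^sub>R y \<in> V)"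
    unfolding convex_def[symmetric] by (intro exI[of _ "ball 0 e"]) auto
qed

definition dual :: "('a::real_lctvs \<Rightarrow> real) set" where
  "dual = {\<mu>. linear \<mu> \<and> continuous_on UNIV \<mu>}"

text \<open>The weak-* topology is the topology of pointwise convergence on the dual.\<close>

definition weak_star_topology :: "('a::real_lctvs \<Rightarrow> real) topology" where
  "weak_star_topology = subtopology (product_topology (\<lambda>_. euclideanreal) UNIV) dual"

definition l_infty :: "(nat \<Rightarrow> real) set" where
  "l_infty = {c. bounded (range c)}"

definition l_one :: "(nat \<Rightarrow> real) set" where
  "l_one = {t. summable (\<lambda>n. \<bar>t n\<bar>)}"

text \<open>
  The value 0 outside of \<open>l_one\<close> is a dummy: \<open>Metric_space\<close> requires nonnegativity and symmetry on
  the whole type, and \<open>suminf\<close> is unspecified for divergent series.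
\<close>

definition l_one_dist :: "(nat \<Rightarrow> real) \<Rightarrow> (nat \<Rightarrow> real) \<Rightarrow> real" where
  "l_one_dist s t = (if s \<in> l_one \<and> t \<in> l_one then \<Sum>n. \<bar>s n - t n\<bar> else 0)"

definition l_one_topology :: "(nat \<Rightarrow> real) topology" where
  "l_one_topology = Metric_space.mtopology l_one l_one_dist"

lemma l_one_diff: "s \<in> l_one \<Longrightarrow> t \<in> l_one \<Longrightarrow> summable (\<lambda>n. \<bar>s n - t n\<bar>)"
  unfolding l_one_def
  by (rule summable_comparison_test[where g = "\<lambda>n. \<bar>s n\<bar> + \<bar>t n\<bar>"])
    (auto intro!: summable_add abs_triangle_ineq4)

lemma Metric_space_l_one: "Metric_space l_one l_one_dist"
proof
  fix s t :: "nat \<Rightarrow> real"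
  show "0 \<le> l_one_dist s t"
    by (auto simp: l_one_dist_def intro!: suminf_nonneg l_one_diff)
  show "l_one_dist s t = l_one_dist t s"
    by (simp add: l_one_dist_def abs_minus_commute)
next
  fix s t :: "nat \<Rightarrow> real" assume "s \<in> l_one" "t \<in> l_one"
  then show "l_one_dist s t = 0 \<longleftrightarrow> s = t"
    using suminf_eq_zero_iff[OF l_one_diff] by (auto simp: l_one_dist_def fun_eq_iff)
next
  fix s t u :: "nat \<Rightarrow> real" assume st: "s \<in> l_one" "t \<in> l_one" and u: "u \<in> l_one"
  have "(\<Sum>n. \<bar>s n - u n\<bar>) \<le> (\<Sum>n. \<bar>s n - t n\<bar> + \<bar>t n - u n\<bar>)"
    using st u
    by (intro suminf_le summable_add l_one_diff) auto
  then show "l_one_dist s u \<le> l_one_dist s t + l_one_dist t u"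
    unfolding l_one_dist_def using st u by (simp add: suminf_add[symmetric] l_one_diff)
qed

lemma topspace_l_one_topology [simp]: "topspace l_one_topology = l_one"
  by (simp add: l_one_topology_def Metric_space.topspace_mtopology[OF Metric_space_l_one])

lemma topspace_weak_star_topology [simp]: "topspace weak_star_topology = dual"
  by (simp add: weak_star_topology_def)

definition ln_ereal :: "ereal \<Rightarrow> ereal" where
  "ln_ereal x = (if x = \<infinity> then \<infinity> else if x \<le> 0 then -\<infinity> else ereal (ln (real_of_ereal x)))"

text \<open>
  Only used for functionals that do not take the value $-\infty$, so that no indeterminate sum
  \<open>\<infinity> + -\<infinity>\<close> occurs; note that \<open>0 * \<infinity> = 0\<close> in \<open>ereal\<close>.
\<close>

definition convex_functional :: "('a::real_vector \<Rightarrow> ereal) \<Rightarrow> bool" where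
  "convex_functional f \<longleftrightarrow> (\<forall>x y u v. 0 \<le> u \<longrightarrow> 0 \<le> v \<longrightarrow> u + v = 1 \<longrightarrow>
     f (u *\<^sub>R x + v *\<^sub>R y) \<le> ereal u * f x + ereal v * f y)"

definition log_convex :: "('a::real_vector \<Rightarrow> ereal) \<Rightarrow> bool" where
  "log_convex r \<longleftrightarrow> convex_functional (\<lambda>x. ln_ereal (r x))"

definition lower_semicontinuous :: "'a topology \<Rightarrow> ('a \<Rightarrow> ereal) \<Rightarrow> bool" where
  "lower_semicontinuous X f \<longleftrightarrow> (\<forall>a. closedin X {x \<in> topspace X. f x \<le> a})"

definition is_lsc_regularization :: "'a topology \<Rightarrow> ('a \<Rightarrow> ereal) \<Rightarrow> ('a \<Rightarrow> ereal) \<Rightarrow> bool" where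
  "is_lsc_regularization X f g \<longleftrightarrow>
     lower_semicontinuous X g \<and> (\<forall>x\<in>topspace X. g x \<le> f x) \<and>
     (\<forall>h. lower_semicontinuous X h \<and> (\<forall>x\<in>topspace X. h x \<le> f x) \<longrightarrow>
          (\<forall>x\<in>topspace X. h x \<le> g x))"

definition conjugate :: "('a::real_lctvs \<Rightarrow> ereal) \<Rightarrow> ('a \<Rightarrow> real) \<Rightarrow> ereal" where
  "conjugate lam \<mu> = (SUP \<phi>. ereal (\<mu> \<phi>) - lam \<phi>)"

definition conjugate_domain :: "('a::real_lctvs \<Rightarrow> ereal) \<Rightarrow> ('a \<Rightarrow> real) set" where
  "conjugate_domain lam = {\<mu> \<in> dual. conjugate lam \<mu> < \<infinity>}"

definition neg_set :: "('a \<Rightarrow> ereal) \<Rightarrow> 'a set" where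
  "neg_set lam = {\<phi>. lam \<phi> < 0}"

text \<open>
  For \<open>lam > -\<infinity>\<close>, the value \<open>lam \<phi>\<close> is a (negative) real number on \<open>neg_set lam\<close>, so the
  conversion with \<open>real_of_ereal\<close> loses nothing and the series converges for bounded \<open>c\<close>.
\<close>

definition lam_hat :: "('a::real_lctvs \<Rightarrow> ereal) \<Rightarrow> (nat \<Rightarrow> real) \<times> 'a \<Rightarrow> ereal" where
  "lam_hat lam = (\<lambda>(c, \<phi>).
     if c \<in> l_infty \<and> \<phi> \<in> neg_set lam
     then ereal (ln (\<Sum>n. exp (c n + real n * real_of_ereal (lam \<phi>))))
     else \<infinity>)"

definition lam_hat_conjugate ::
  "('a::real_lctvs \<Rightarrow> ereal) \<Rightarrow> (nat \<Rightarrow> real) \<times> ('a \<Rightarrow> real) \<Rightarrow> ereal" where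
  "lam_hat_conjugate lam = (\<lambda>(t, \<mu>).
     SUP (c, \<phi>) \<in> l_infty \<times> UNIV. ereal ((\<Sum>n. c n * t n) + \<mu> \<phi>) - lam_hat lam (c, \<phi>))"

definition S_tilde :: "(nat \<Rightarrow> real) set" where
  "S_tilde = {t. (\<forall>n. 0 \<le> t n) \<and> t sums 1 \<and> summable (\<lambda>n. real n * t n)}"

definition e_zero :: "nat \<Rightarrow> real" where
  "e_zero = (\<lambda>n. if n = 0 then 1 else 0)"

definition mean :: "(nat \<Rightarrow> real) \<Rightarrow> real" where
  "mean t = (\<Sum>n. real n * t n)"

definition tau_hat_domain ::
  "('a::real_lctvs \<Rightarrow> ereal) \<Rightarrow> ((nat \<Rightarrow> real) \<times> ('a \<Rightarrow> real)) set" where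
  "tau_hat_domain lam = {(t, \<mu>) \<in> l_one \<times> dual.
     t \<in> S_tilde - {e_zero} \<and> (\<lambda>\<phi>. \<mu> \<phi> / mean t) \<in> conjugate_domain lam}"

text \<open>The convention $0 \ln 0 = 0$ holds automatically.\<close>

definition tau_hat ::
  "('a::real_lctvs \<Rightarrow> ereal) \<Rightarrow> (nat \<Rightarrow> real) \<times> ('a \<Rightarrow> real) \<Rightarrow> ereal" where
  "tau_hat lam = (\<lambda>(t, \<mu>).
     if (t, \<mu>) \<in> tau_hat_domain lam
     then ereal (mean t) * conjugate lam (\<lambda>\<phi>. \<mu> \<phi> / mean t) + ereal (\<Sum>n. t n * ln (t n))
     else \<infinity>)"

end

theory Submission
  imports Defs
begin

text \<open>
  Write $\lambda$ for \<open>lam\<close>, $m(t) = \sum n t_n$ for the mean and $H(t) = \sum t_n \ln t_n$.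

  For a fixed $\varphi$ with $\lambda(\varphi) < 0$, the supremum over $c$ is the Gibbs variational formula for the
  weights $e^{n \lambda(\varphi)}$: it equals $H(t) - m(t) \lambda(\varphi)$ if $t$ is a probability sequence with finite
  mean, and is infinite otherwise (\<open>gibbs_inequality\<close>, \<open>S_tilde_of_conjugate_bounded\<close>,
  \<open>entropy_le_of_conjugate_bounded\<close>). So the conjugate is
  \[ H(t) + \sup \{ \mu(\varphi) - m(t) \lambda(\varphi) \mid \lambda(\varphi) < 0 \}, \]
  whereas $\hat\tau(t, \mu)$ is, for $t \ne e_0$, the same expression with the constraint $\lambda(\varphi) < 0$
  relaxed to $\lambda(\varphi) < \infty$, and $\hat\tau(e_0, \mu) = \infty$. This gives
  the inequality between the two; lower semicontinuity holds because the conjugate is a supremum of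
  continuous affine functionals.

  It remains to approach a point $(t, \mu)$ with conjugate at most $g$ by points at which $\hat\tau$ is
  asymptotically at most $g$. The constraint is a scalar one and has a strictly feasible point, so it can
  be traded for a Lagrange multiplier $s \ge 0$ (\<open>lagrange_multiplier_exists\<close>):
  \[ \mu(\varphi) - (m(t) + s) \lambda(\varphi) \le g - H(t) \quad\mbox{whenever } \lambda(\varphi) < \infty. \]
  The left-hand side is the one that belongs to a sequence with mean $m(t) + s$. Such a sequence exists
  arbitrarily close to $t$ in $l_1$: moving a small mass $\delta$ to a far away index $N$ changes the mean by
  about $\delta N$ and, by convexity of $x \ln x$, does not raise the entropy term above $(1 - \delta) H(t)$.

  The mean $m(t) + s$ may vanish, which happens only for $t = e_0$. For this reason $\mu$ is perturbed as
  well, to $\mu + \epsilon \nu$ with mean $m(t) + s + \epsilon$, where $\nu$ is a continuous functional such that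
  $\nu - \lambda$ is bounded above. The existence of $\nu$ is the only place where semicontinuity of
  $\lambda$ and local convexity of the space enter; it follows from the Hahn--Banach theorem
  (\<open>linear_below_sublinear\<close>, \<open>continuous_affine_minorant\<close>).
\<close>

section \<open>Sublinear functionals and the Hahn--Banach theorem\<close>

definition sublinear :: "('a::real_vector \<Rightarrow> real) \<Rightarrow> bool" where
  "sublinear p \<longleftrightarrow> (\<forall>x y. p (x + y) \<le> p x + p y) \<and> (\<forall>c>0. \<forall>x. p (c *\<^sub>R x) \<le> c * p x)"

lemma sublinear_add: "sublinear p \<Longrightarrow> p (x + y) \<le> p x + p y"
  by (simp add: sublinear_def)

lemma sublinear_scaleR:
  assumes "sublinear p" "c > 0"
  shows "p (c *\<^sub>R x) = c * p x"
proof (rule antisym)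
  show "p (c *\<^sub>R x) \<le> c * p x"
    using assms by (simp add: sublinear_def)
  have "p (inverse c *\<^sub>R c *\<^sub>R x) \<le> inverse c * p (c *\<^sub>R x)"
    using assms by (metis sublinear_def inverse_positive_iff_positive)
  then show "c * p x \<le> p (c *\<^sub>R x)"
    using assms(2) by (simp add: field_simps)
qed

lemma sublinear_zero: "sublinear p \<Longrightarrow> p 0 = 0"
  using sublinear_scaleR[of p 2 0] by simp

lemma sublinear_minus: "sublinear p \<Longrightarrow> - p (- x) \<le> p x"
  using sublinear_add[of p x "- x"] sublinear_zero[of p] by simp

text \<open>
  The lower envelope of a convex cone in the product of the space with the real line. All sublinear
  functionals constructed below arise in this way, so that infima are handled only once.
\<close>

lemma sublinear_Inf_cone:
  fixes K :: "'a::real_vector \<Rightarrow> real \<Rightarrow> bool"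
  assumes add: "\<And>x y a b. K x a \<Longrightarrow> K y b \<Longrightarrow> K (x + y) (a + b)"
    and scale: "\<And>c x a. c > 0 \<Longrightarrow> K x a \<Longrightarrow> K (c *\<^sub>R x) (c * a)"
    and ex: "\<And>x. \<exists>a. K x a"
    and bdd: "\<And>x. bdd_below {a. K x a}"
  shows "sublinear (\<lambda>x. Inf {a. K x a})"
  unfolding sublinear_def
proof (intro conjI allI impI)
  have lower: "Inf {a. K x a} \<le> a" if "K x a" for x a
    using that bdd by (auto intro: cInf_lower)
  fix x y
  have "Inf {a. K (x + y) a} - a \<le> Inf {b. K y b}" if "K x a" for a
  proof (rule cInf_greatest)
    fix b assume "b \<in> {b. K y b}"
    then have "Inf {a. K (x + y) a} \<le> a + b"
      using lower add that by auto
    then show "Inf {a. K (x + y) a} - a \<le> b" by simp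
  qed (use ex in auto)
  then have "Inf {a. K (x + y) a} - Inf {b. K y b} \<le> a" if "K x a" for a
    using that by (simp add: algebra_simps)
  then have "Inf {a. K (x + y) a} - Inf {b. K y b} \<le> Inf {a. K x a}"
    using ex by (intro cInf_greatest) auto
  then show "Inf {a. K (x + y) a} \<le> Inf {a. K x a} + Inf {b. K y b}"
    by simp
  fix c :: real assume c: "c > 0"
  have "Inf {a. K (c *\<^sub>R x) a} / c \<le> Inf {a. K x a}"
  proof (rule cInf_greatest)
    fix a assume "a \<in> {a. K x a}"
    then have "Inf {a. K (c *\<^sub>R x) a} \<le> c * a"
      using lower[OF scale[OF c, of x a]] by simp
    then show "Inf {a. K (c *\<^sub>R x) a} / c \<le> a"
      using c by (simp add: pos_divide_le_eq mult.commute)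
  qed (use ex in auto)
  then show "Inf {a. K (c *\<^sub>R x) a} \<le> c * Inf {a. K x a}"
    using c by (simp add: pos_divide_le_eq mult.commute)
qed

text \<open>
  A sublinear functional can be lowered as far as \<open>- p y\<close> at \<open>- y\<close>. A functional that admits no
  strictly smaller sublinear one is therefore odd, hence linear.
\<close>

lemma sublinear_lowering:
  assumes p: "sublinear p"
  obtains q where "sublinear q" "\<And>x. q x \<le> p x" "q (- y) \<le> - p y"
proof -
  define K where "K = (\<lambda>x a. \<exists>s\<ge>0. p (x + s *\<^sub>R y) - s * p y \<le> a)"
  have py: "p (s *\<^sub>R y) = s * p y" if "s \<ge> 0" for s
    using that sublinear_scaleR[OF p, of s y] sublinear_zero[OF p] by (cases "s = 0") auto
  have bdd: "bdd_below {a. K x a}" for x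
  proof (rule bdd_belowI)
    fix a assume "a \<in> {a. K x a}"
    then obtain s where s: "s \<ge> 0" "p (x + s *\<^sub>R y) - s * p y \<le> a"
      by (auto simp: K_def)
    have "p (s *\<^sub>R y) \<le> p (x + s *\<^sub>R y) + p (- x)"
      using sublinear_add[OF p, of "x + s *\<^sub>R y" "- x"] by simp
    then show "- p (- x) \<le> a" using s py by simp
  qed
  have "sublinear (\<lambda>x. Inf {a. K x a})"
  proof (rule sublinear_Inf_cone[OF _ _ _ bdd])
    fix x x' a a' assume "K x a" "K x' a'"
    then obtain s s' where s: "s \<ge> 0" "p (x + s *\<^sub>R y) - s * p y \<le> a"
        "s' \<ge> 0" "p (x' + s' *\<^sub>R y) - s' * p y \<le> a'"
      by (auto simp: K_def)
    have "p ((x + x') + (s + s') *\<^sub>R y) \<le> p (x + s *\<^sub>R y) + p (x' + s' *\<^sub>R y)"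
      using sublinear_add[OF p, of "x + s *\<^sub>R y" "x' + s' *\<^sub>R y"] by (simp add: algebra_simps)
    then show "K (x + x') (a + a')"
      unfolding K_def using s by (intro exI[of _ "s + s'"]) (auto simp: algebra_simps)
  next
    fix c x a assume c: "(c::real) > 0" "K x a"
    then obtain s where s: "s \<ge> 0" "p (x + s *\<^sub>R y) - s * p y \<le> a"
      by (auto simp: K_def)
    have "p (c *\<^sub>R x + (c * s) *\<^sub>R y) = c * p (x + s *\<^sub>R y)"
      using sublinear_scaleR[OF p c(1), of "x + s *\<^sub>R y"] by (simp add: algebra_simps)
    then have "p (c *\<^sub>R x + (c * s) *\<^sub>R y) - (c * s) * p y = c * (p (x + s *\<^sub>R y) - s * p y)"
      by (simp add: algebra_simps)
    also have "\<dots> \<le> c * a" using s c by (intro mult_left_mono) auto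
    finally show "K (c *\<^sub>R x) (c * a)"
      unfolding K_def using s c by (intro exI[of _ "c * s"]) auto
  qed (auto simp: K_def)
  moreover have "Inf {a. K x a} \<le> p x" for x
    by (rule cInf_lower[OF _ bdd]) (auto simp: K_def intro: exI[of _ "0::real"])
  moreover have "Inf {a. K (- y) a} \<le> - p y"
    by (rule cInf_lower[OF _ bdd]) (auto simp: K_def sublinear_zero[OF p] intro: exI[of _ "1::real"])
  ultimately show thesis using that by blast
qed

text \<open>The Hahn--Banach theorem, from a minimal sublinear functional below the given one.\<close>

theorem linear_below_sublinear:
  assumes p: "sublinear p"
  obtains f where "linear f" "\<And>x. f x \<le> p x"
proof -
  define A where "A = {q. sublinear q \<and> q \<le> p}"
  have "\<exists>m\<in>A. \<forall>q\<in>A. m \<ge> q \<longrightarrow> q = m"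
  proof (rule predicate_Zorn)
    show "partial_order_on A (relation_of (\<ge>) A)"
      by (rule partial_order_on_relation_ofI) auto
  next
    fix C assume C: "C \<in> Chains (relation_of (\<ge>) A)"
    then have CA: "C \<subseteq> A" and chain: "\<And>q q'. q \<in> C \<Longrightarrow> q' \<in> C \<Longrightarrow> q \<ge> q' \<or> q' \<ge> q"
      by (auto simp: Chains_def relation_of_def)
    show "\<exists>u\<in>A. \<forall>q\<in>C. q \<ge> u"
    proof (cases "C = {}")
      case True
      then show ?thesis using p by (auto simp: A_def)
    next
      case False
      then obtain q0 where q0: "q0 \<in> C" by auto
      define K where "K = (\<lambda>x a. \<exists>q\<in>C. q x \<le> a)"
      have sub: "sublinear q" "q x \<le> p x" if "q \<in> C" for q x
        using that CA by (auto simp: A_def le_fun_def)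
      have bdd: "bdd_below {a. K x a}" for x
      proof (rule bdd_belowI)
        fix a assume "a \<in> {a. K x a}"
        then obtain q where q: "q \<in> C" "q x \<le> a" by (auto simp: K_def)
        then show "- p (- x) \<le> a"
          using sublinear_minus[OF sub(1), of q x] sub(2)[of q "- x"] by simp
      qed
      have u: "sublinear (\<lambda>x. Inf {a. K x a})"
      proof (rule sublinear_Inf_cone[OF _ _ _ bdd])
        fix x y a b assume "K x a" "K y b"
        then obtain q q' where q: "q \<in> C" "q x \<le> a" "q' \<in> C" "q' y \<le> b"
          by (auto simp: K_def)
        obtain q'' where q'': "q'' \<in> C" "q'' \<le> q" "q'' \<le> q'"
          using chain[OF q(1,3)] q by blast
        then have "q'' (x + y) \<le> q'' x + q'' y" "q'' x \<le> q x" "q'' y \<le> q' y"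
          using sublinear_add[OF sub(1)] by (auto simp: le_fun_def)
        then have "q'' (x + y) \<le> a + b" using q by linarith
        then show "K (x + y) (a + b)" using q'' by (auto simp: K_def)
      next
        fix c x a assume "(c::real) > 0" "K x a"
        then show "K (c *\<^sub>R x) (c * a)"
          using sub(1) by (auto simp: K_def sublinear_scaleR)
      next
        fix x show "\<exists>a. K x a" using q0 by (auto simp: K_def)
      qed
      have le: "Inf {a. K x a} \<le> q x" if "q \<in> C" for q x
        by (rule cInf_lower[OF _ bdd]) (use that in \<open>auto simp: K_def\<close>)
      have "(\<lambda>x. Inf {a. K x a}) \<in> A"
        using u order_trans[OF le[OF q0] sub(2)[OF q0]] by (auto simp: A_def le_fun_def)
      then show ?thesis using le by (auto simp: le_fun_def intro!: bexI)
    qed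
  qed
  then obtain m where m: "sublinear m" "m \<le> p" and min: "\<And>q. sublinear q \<Longrightarrow> q \<le> m \<Longrightarrow> q = m"
    unfolding A_def by (auto intro: order_trans)
  have odd: "m (- y) = - m y" for y
  proof (rule antisym)
    obtain q where "sublinear q" "\<And>x. q x \<le> m x" "q (- y) \<le> - m y"
      using sublinear_lowering[OF m(1), of y] by blast
    then show "m (- y) \<le> - m y" using min[of q] by (auto simp: le_fun_def)
    show "- m y \<le> m (- y)" using sublinear_minus[OF m(1), of "- y"] by simp
  qed
  have add: "m (x + y) = m x + m y" for x y
    using sublinear_add[OF m(1), of x y] sublinear_add[OF m(1), of "x + y" "- y"] odd[of y] by simp
  have "m (c *\<^sub>R x) = c * m x" for c x
  proof -
    consider "c > 0" | "c = 0" | "c < 0" by linarith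
    then show ?thesis
    proof cases
      case 3
      then have "m ((- c) *\<^sub>R x) = - c * m x"
        by (intro sublinear_scaleR[OF m(1)]) auto
      then show ?thesis using odd[of "c *\<^sub>R x"] by simp
    qed (use sublinear_scaleR[OF m(1)] sublinear_zero[OF m(1)] in auto)
  qed
  then have "linear m" using add by (intro linearI) auto
  then show thesis using that m(2) by (auto simp: le_fun_def)
qed

section \<open>Continuous affine minorants of convex functions\<close>

lemma real_lctvs_tendsto_scaleR:
  fixes g :: "'b \<Rightarrow> 'a::real_lctvs"
  assumes "(f \<longlongrightarrow> a) F" "(g \<longlongrightarrow> b) F"
  shows "((\<lambda>x. f x *\<^sub>R g x) \<longlongrightarrow> a *\<^sub>R b) F"
  using filterlim_compose[OF tendsto_scaleR_Pair filterlim_Pair[OF assms]] by simp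

text \<open>
  By homogeneity, the bound on a neighbourhood shrinks with the neighbourhood, which yields continuity at
  $0$; translations carry it to every other point.
\<close>

lemma dual_if_bounded_above_near_0:
  fixes \<nu> :: "'a::real_lctvs \<Rightarrow> real"
  assumes lin: "linear \<nu>" and V: "open V" "0 \<in> V" and le: "\<And>x. x \<in> V \<Longrightarrow> \<nu> x \<le> b"
  shows "\<nu> \<in> dual"
proof -
  have at0: "(\<nu> \<longlongrightarrow> 0) (nhds 0)"
  proof (rule tendstoI)
    fix e :: real assume e: "e > 0"
    define c where "c = (\<bar>b\<bar> + 1) / e"
    have c: "c > 0" using e by (simp add: c_def field_simps add_pos_nonneg)
    have "((\<lambda>x. c *\<^sub>R x) \<longlongrightarrow> c *\<^sub>R 0) (nhds (0::'a))" "((\<lambda>x. (- c) *\<^sub>R x) \<longlongrightarrow> (- c) *\<^sub>R 0) (nhds (0::'a))"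
      by (intro real_lctvs_tendsto_scaleR tendsto_const filterlim_ident)+
    then have "\<forall>\<^sub>F x in nhds 0. c *\<^sub>R x \<in> V" "\<forall>\<^sub>F x in nhds 0. (- c) *\<^sub>R x \<in> V"
      using V by (auto dest: topological_tendstoD)
    then show "\<forall>\<^sub>F x in nhds 0. dist (\<nu> x) 0 < e"
    proof eventually_elim
      case (elim x)
      have "c * \<nu> x \<le> b" "- c * \<nu> x \<le> b"
        using le[OF elim(1)] le[OF elim(2)] linear_cmul[OF lin, of c x] linear_cmul[OF lin, of "- c" x]
        by simp_all
      then have "c * \<bar>\<nu> x\<bar> < \<bar>b\<bar> + 1" by (cases "\<nu> x \<ge> 0") auto
      then have "\<bar>\<nu> x\<bar> < (\<bar>b\<bar> + 1) / c"
        using c by (simp add: field_simps)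
      also have "(\<bar>b\<bar> + 1) / c = e" using e by (simp add: c_def add_nonneg_pos)
      finally show ?case by simp
    qed
  qed
  have "(\<nu> \<longlongrightarrow> \<nu> x) (nhds x)" for x
  proof -
    have "((\<lambda>y. y - x) \<longlongrightarrow> x - x) (nhds x)"
      by (intro tendsto_diff filterlim_ident tendsto_const)
    then have "((\<lambda>y. \<nu> (y - x)) \<longlongrightarrow> 0) (nhds x)"
      using filterlim_compose[OF at0] by simp
    then have "((\<lambda>y. \<nu> (y - x) + \<nu> x) \<longlongrightarrow> 0 + \<nu> x) (nhds x)"
      by (intro tendsto_add tendsto_const)
    then show ?thesis by (simp add: linear_diff[OF lin])
  qed
  then show ?thesis
    using lin by (auto simp: dual_def continuous_on_def at_within_def intro: tendsto_mono[OF inf_le1])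
qed

text \<open>
  A convex combination rescaled to arbitrary nonnegative weights. The weights may both vanish, which
  spares case distinctions when cones over convex sets are added.
\<close>

lemma convex_on_cone_combination:
  fixes x y :: "'a::real_vector"
  assumes g: "convex_on D g" and D: "x \<in> D" "y \<in> D" and st: "s \<ge> 0" "t \<ge> 0"
  obtains z where "z \<in> D" "(s + t) *\<^sub>R z = s *\<^sub>R x + t *\<^sub>R y" "(s + t) * g z \<le> s * g x + t * g y"
proof (cases "s + t = 0")
  case True
  then have "s = 0" "t = 0" using st by linarith+
  then show ?thesis using that[of x] D by simp
next
  case False
  then have pos: "s + t > 0" using st by linarith
  define z where "z = (s / (s + t)) *\<^sub>R x + (t / (s + t)) *\<^sub>R y"
  have w: "s / (s + t) \<ge> 0" "t / (s + t) \<ge> 0" "s / (s + t) + t / (s + t) = 1"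
    using st pos by (auto simp: add_divide_distrib[symmetric])
  have "z \<in> D"
    unfolding z_def using convex_on_imp_convex[OF g] w D by (simp add: convex_def)
  moreover have "(s + t) *\<^sub>R z = s *\<^sub>R x + t *\<^sub>R y"
    using pos by (simp add: z_def scaleR_add_right)
  moreover have "g z \<le> s / (s + t) * g x + t / (s + t) * g y"
    using g w D unfolding z_def convex_on_def by blast
  then have "(s + t) * g z \<le> (s + t) * (s / (s + t) * g x + t / (s + t) * g y)"
    using pos by (intro mult_left_mono) auto
  then have "(s + t) * g z \<le> s * g x + t * g y"
    using pos by (simp add: distrib_left)
  ultimately show ?thesis by (rule that)
qed

lemma open_set_absorbing:
  fixes V :: "'a::real_lctvs set"
  assumes "open V" "0 \<in> V"
  obtains r w where "r > 0" "w \<in> V" "x = r *\<^sub>R w"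
proof -
  have "((\<lambda>c::real. c *\<^sub>R x) \<longlongrightarrow> 0 *\<^sub>R x) (at_right 0)"
    by (intro real_lctvs_tendsto_scaleR tendsto_const) (simp add: tendsto_ident_at)
  then have "\<forall>\<^sub>F c in at_right (0::real). c *\<^sub>R x \<in> V"
    using assms by (auto dest: topological_tendstoD)
  moreover have "\<forall>\<^sub>F c in at_right (0::real). c > 0"
    by (simp add: eventually_at_right_less)
  ultimately have "\<forall>\<^sub>F c in at_right (0::real). c > 0 \<and> c *\<^sub>R x \<in> V"
    by eventually_elim auto
  then obtain c :: real where "c > 0" "c *\<^sub>R x \<in> V"
    using eventually_happens[of _ "at_right (0::real)"] by (auto simp: trivial_limit_at_right_real)
  then show thesis using that[of "1 / c" "c *\<^sub>R x"] by auto
qed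

text \<open>
  Let $V$ be a symmetric convex neighbourhood of $0$ with $x_0 + V \subseteq U$ and $\beta = g(x_0) - b$. Convexity along the
  segment from $x_0$ turns the bound on $U$ into a linear one: $g(y) - b \ge - \rho \beta$ if $y - x_0 \in \rho V$.
  Hence the convex cone generated by the pairs $(v, \beta)$ with $v \in V$ and $(x_0 - y, g(y) - b)$ with
  $y \in D$ has a finite lower envelope. A linear functional below this envelope is bounded on $V$,
  hence continuous, and its negative lies below $g$ up to a constant.
\<close>

lemma continuous_affine_minorant:
  fixes g :: "'a::real_lctvs \<Rightarrow> real"
  assumes g: "convex_on D g" and x0: "x0 \<in> D" "x0 \<in> U" and U: "open U"
    and b: "\<And>x. x \<in> D \<Longrightarrow> x \<in> U \<Longrightarrow> b \<le> g x"
  obtains \<nu> K where "\<nu> \<in> dual" "\<And>x. x \<in> D \<Longrightarrow> \<nu> x - g x \<le> K"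
proof -
  have "continuous_on UNIV (\<lambda>x. x + x0)"
    by (intro continuous_intros)
  then have "open ((\<lambda>x. x + x0) -` U)" "0 \<in> (\<lambda>x. x + x0) -` U"
    using U x0 by (auto simp: continuous_on_open_vimage)
  then obtain V0 where V0: "open V0" "0 \<in> V0" "V0 \<subseteq> (\<lambda>x. x + x0) -` U" "convex V0"
    using ex_open_convex by blast
  define V where "V = V0 \<inter> uminus -` V0"
  have "open (uminus -` V0)"
    using V0(1) continuous_on_minus[OF continuous_on_id, of UNIV]
    by (metis continuous_on_open_vimage open_UNIV Int_UNIV_right)
  then have V: "open V" "0 \<in> V"
    using V0 by (auto simp: V_def)
  have "convex (uminus -` V0)"
    using V0(4) by (intro convex_linear_vimage module_hom_uminus)
  then have cV: "convex V" using V0(4) by (simp add: V_def convex_Int)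
  have symV: "- v \<in> V" if "v \<in> V" for v using that by (auto simp: V_def)
  have VU: "x0 + v \<in> U" if "v \<in> V" for v using that V0(3) by (auto simp: V_def add.commute)
  define \<beta> where "\<beta> = g x0 - b"
  have \<beta>: "\<beta> \<ge> 0" using b x0 by (simp add: \<beta>_def)
  \<comment> \<open>If \<open>\<rho> > 1\<close>, the point \<open>x0 + v\<close> of \<open>U\<close> lies between \<open>x0\<close> and \<open>y\<close>.\<close>
  have lower: "- \<rho> * \<beta> \<le> g y - b" if "y \<in> D" "v \<in> V" "\<rho> \<ge> 0" "y - x0 = \<rho> *\<^sub>R v" for y v \<rho>
  proof (cases "\<rho> \<le> 1")
    case True
    have "\<rho> *\<^sub>R v + (1 - \<rho>) *\<^sub>R 0 \<in> V"
      using cV that V(2) True by (intro convexD) auto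
    then have "x0 + \<rho> *\<^sub>R v \<in> U" by (intro VU) simp
    moreover have "x0 + \<rho> *\<^sub>R v = y" by (simp flip: that(4))
    ultimately have "y \<in> U" by simp
    then have "0 \<le> g y - b" using b[OF that(1)] by simp
    moreover have "0 \<le> \<rho> * \<beta>" using \<beta> that(3) by simp
    ultimately show ?thesis by simp
  next
    case False
    define z where "z = (1 - 1 / \<rho>) *\<^sub>R x0 + (1 / \<rho>) *\<^sub>R y"
    have "y = x0 + \<rho> *\<^sub>R v" using that(4) by (simp add: algebra_simps)
    then have z: "z = x0 + v" using False by (simp add: z_def algebra_simps)
    have "z \<in> D"
      unfolding z_def using convex_on_imp_convex[OF g] x0 that(1) False by (intro convexD) auto
    then have "b \<le> g z" using b VU[OF that(2)] z by auto
    also have "g z \<le> (1 - 1 / \<rho>) * g x0 + (1 / \<rho>) * g y"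
      unfolding z_def using convex_onD[OF g, of "1 / \<rho>" x0 y] x0 that(1) False by simp
    finally have "\<rho> * b \<le> \<rho> * ((1 - 1 / \<rho>) * g x0 + (1 / \<rho>) * g y)"
      using False by (intro mult_left_mono) auto
    also have "\<dots> = (\<rho> - 1) * g x0 + g y" using False by (simp add: field_simps)
    finally have "- (\<rho> - 1) * \<beta> \<le> g y - b" by (simp add: \<beta>_def algebra_simps)
    then show ?thesis using \<beta> by (simp add: algebra_simps)
  qed
  define K where "K = (\<lambda>x a. \<exists>s\<ge>0. \<exists>t\<ge>0. \<exists>v\<in>V. \<exists>y\<in>D.
    x = s *\<^sub>R v - t *\<^sub>R (y - x0) \<and> s * \<beta> + t * (g y - b) \<le> a)"
  have bdd: "bdd_below {a. K x a}" for x
  proof -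
    \<comment> \<open>If \<open>x \<in> r V\<close>, every representation of \<open>x\<close> in the cone has \<open>t (y - x0) \<in> (s + r) V\<close>.\<close>
    obtain r w where r: "r > 0" "w \<in> V" "x = r *\<^sub>R w"
      using open_set_absorbing[OF V] by blast
    show ?thesis
    proof (rule bdd_belowI)
      fix a assume "a \<in> {a. K x a}"
      then obtain s t v y where s: "s \<ge> 0" "t \<ge> 0" "v \<in> V" "y \<in> D"
          "x = s *\<^sub>R v - t *\<^sub>R (y - x0)" "s * \<beta> + t * (g y - b) \<le> a"
        by (auto simp: K_def)
      have "- r * \<beta> \<le> s * \<beta> + t * (g y - b)"
      proof (cases "t = 0")
        case True
        have "0 \<le> (s + r) * \<beta>" using s r \<beta> by simp
        then show ?thesis using True by (simp add: algebra_simps)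
      next
        case False
        obtain u where u: "u \<in> V" "(s + r) *\<^sub>R u = s *\<^sub>R v + r *\<^sub>R (- w)"
          using convex_on_cone_combination[of V "\<lambda>_. 0" v "- w" s r] cV s r symV
          by (auto simp: convex_on_def)
        have "t *\<^sub>R (y - x0) = (s + r) *\<^sub>R u"
        proof -
          have "t *\<^sub>R (y - x0) = s *\<^sub>R v - x" using s(5) by simp
          also have "\<dots> = (s + r) *\<^sub>R u" using u(2) r(3) by simp
          finally show ?thesis .
        qed
        then have "(1 / t) *\<^sub>R t *\<^sub>R (y - x0) = (1 / t) *\<^sub>R (s + r) *\<^sub>R u" by simp
        then have "y - x0 = ((s + r) / t) *\<^sub>R u" using False by simp
        then have "- ((s + r) / t) * \<beta> \<le> g y - b"
          using s r u by (intro lower[of y u]) auto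
        then have "t * (- ((s + r) / t) * \<beta>) \<le> t * (g y - b)"
          using s by (intro mult_left_mono) auto
        moreover have "t * (- ((s + r) / t) * \<beta>) = - ((s + r) * \<beta>)" using False by simp
        ultimately show ?thesis by (simp add: algebra_simps)
      qed
      then show "- r * \<beta> \<le> a" using s by simp
    qed
  qed
  have sub: "sublinear (\<lambda>x. Inf {a. K x a})"
  proof (rule sublinear_Inf_cone[OF _ _ _ bdd])
    fix x x' a a' assume "K x a" "K x' a'"
    then obtain s t v y s' t' v' y' where
      s: "s \<ge> 0" "t \<ge> 0" "v \<in> V" "y \<in> D"
        "x = s *\<^sub>R v - t *\<^sub>R (y - x0)" "s * \<beta> + t * (g y - b) \<le> a" and
      s': "s' \<ge> 0" "t' \<ge> 0" "v' \<in> V" "y' \<in> D"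
        "x' = s' *\<^sub>R v' - t' *\<^sub>R (y' - x0)" "s' * \<beta> + t' * (g y' - b) \<le> a'"
      unfolding K_def by metis
    obtain u where u: "u \<in> V" "(s + s') *\<^sub>R u = s *\<^sub>R v + s' *\<^sub>R v'"
      using convex_on_cone_combination[of V "\<lambda>_. 0" v v' s s'] cV s s'
      by (auto simp: convex_on_def)
    obtain z where z: "z \<in> D" "(t + t') *\<^sub>R z = t *\<^sub>R y + t' *\<^sub>R y'"
        "(t + t') * g z \<le> t * g y + t' * g y'"
      using convex_on_cone_combination[OF g s(4) s'(4) s(2) s'(2)] by blast
    have "x + x' = (s + s') *\<^sub>R u - (t + t') *\<^sub>R (z - x0)"
    proof -
      have "x + x' = (s *\<^sub>R v + s' *\<^sub>R v') - ((t *\<^sub>R y + t' *\<^sub>R y') - (t + t') *\<^sub>R x0)"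
        unfolding s(5) s'(5) by (simp add: algebra_simps)
      then show ?thesis using u(2) z(2) by (simp add: scaleR_diff_right)
    qed
    moreover have "(s + s') * \<beta> + (t + t') * (g z - b) \<le> a + a'"
      using z(3) s(6) s'(6) by (simp add: algebra_simps)
    ultimately show "K (x + x') (a + a')"
      unfolding K_def using s(1,2) s'(1,2) u(1) z(1) by (meson add_nonneg_nonneg)
  next
    fix c x a assume c: "(c::real) > 0" "K x a"
    then obtain s t v y where s: "s \<ge> 0" "t \<ge> 0" "v \<in> V" "y \<in> D"
        "x = s *\<^sub>R v - t *\<^sub>R (y - x0)" "s * \<beta> + t * (g y - b) \<le> a"
      by (auto simp: K_def)
    have "c *\<^sub>R x = (c * s) *\<^sub>R v - (c * t) *\<^sub>R (y - x0)"
      by (simp add: s(5) scaleR_diff_right)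
    moreover have "(c * s) * \<beta> + (c * t) * (g y - b) \<le> c * a"
      using mult_left_mono[OF s(6), of c] c by (simp add: algebra_simps)
    moreover have "c * s \<ge> 0" "c * t \<ge> 0" using c s by auto
    ultimately show "K (c *\<^sub>R x) (c * a)"
      unfolding K_def using s(3,4) by blast
  next
    fix x
    obtain r w where r: "r > 0" "w \<in> V" "x = r *\<^sub>R w"
      using open_set_absorbing[OF V] by blast
    show "\<exists>a. K x a"
      unfolding K_def using r x0
      by (intro exI[of _ "r * \<beta>"] exI[of _ r] conjI exI[of _ "0::real"] bexI[of _ w] bexI[of _ x0]) auto
  qed
  obtain f where f: "linear f" and fP: "\<And>x. f x \<le> Inf {a. K x a}"
    using linear_below_sublinear[OF sub] by blast
  have le: "f x \<le> a" if "K x a" for x a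
    using fP[of x] cInf_lower[OF _ bdd, of a x] that by auto
  have fV: "f v \<le> \<beta>" if "v \<in> V" for v
  proof (rule le)
    show "K v \<beta>"
      unfolding K_def using that x0
      by (intro exI[of _ "1::real"] conjI exI[of _ "0::real"] bexI[of _ v] bexI[of _ x0]) auto
  qed
  have fD: "- f (y - x0) \<le> g y - b" if "y \<in> D" for y
  proof -
    have "K (- (y - x0)) (g y - b)"
      unfolding K_def using that V
      by (intro exI[of _ "0::real"] conjI exI[of _ "1::real"] bexI[of _ "0::'a"] bexI[of _ y]) auto
    then have "f (- (y - x0)) \<le> g y - b" by (rule le)
    then show ?thesis by (simp add: linear_neg[OF f] del: minus_diff_eq)
  qed
  have "(\<lambda>x. - f x) \<in> dual"
  proof (rule dual_if_bounded_above_near_0[OF _ V])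
    show "linear (\<lambda>x. - f x)" using f by (rule linear_compose_neg)
    show "- f x \<le> \<beta>" if "x \<in> V" for x
      using fV[OF symV[OF that]] by (simp add: linear_neg[OF f])
  qed
  moreover have "- f x - g x \<le> - f x0 - b" if "x \<in> D" for x
    using fD[OF that] by (simp add: linear_diff[OF f])
  ultimately show thesis by (rule that)
qed

section \<open>A Lagrange multiplier under Slater's condition\<close>

text \<open>
  The conditions on $s$ are $s \le f(x) / g(x)$ for $g(x) < 0$ and $s \ge f(y) / g(y)$ for $g(y) > 0$. They are
  compatible because the segment from $x$ to $y$ crosses the set where $g < 0$ up to its boundary, and
  $f \le 0$ there.
\<close>

lemma lagrange_multiplier_exists:
  fixes f g :: "'a::real_vector \<Rightarrow> real"
  assumes g: "convex_on D g" and f: "concave_on D f"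
    and x0: "x0 \<in> D" "g x0 < 0" and neg: "\<And>x. x \<in> D \<Longrightarrow> g x < 0 \<Longrightarrow> f x \<le> 0"
  obtains s where "s \<ge> 0" "\<And>x. x \<in> D \<Longrightarrow> f x \<le> s * g x"
proof -
  have cross: "g y * f x \<le> g x * f y" if x: "x \<in> D" "g x < 0" and y: "y \<in> D" "g y \<ge> 0" for x y
  proof (rule field_le_epsilon)
    fix e :: real assume e: "e > 0"
    \<comment> \<open>The weights \<open>g y\<close> and \<open>- g x\<close> only yield \<open>g z \<le> 0\<close>; the first is enlarged to make this strict.\<close>
    define \<epsilon> where "\<epsilon> = e / (1 - f x)"
    have fx: "f x \<le> 0" using neg x by auto
    then have \<epsilon>: "\<epsilon> > 0" "\<epsilon> * (- f x) \<le> e" using e by (auto simp: \<epsilon>_def field_simps)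
    have "convex_on D (\<lambda>z. - f z)" using f by (simp add: concave_on_def)
    have w: "0 \<le> (g y + \<epsilon>)" "0 \<le> - g x" "g y + \<epsilon> + - g x > 0" using x y \<epsilon> by auto
    define S where "S = g y + \<epsilon> + - g x"
    define z where "z = ((g y + \<epsilon>) / S) *\<^sub>R x + (- g x / S) *\<^sub>R y"
    have S: "S > 0" "(g y + \<epsilon>) / S + - g x / S = 1" "(g y + \<epsilon>) / S \<ge> 0" "- g x / S \<ge> 0"
      using w unfolding S_def
      by (simp only: add_divide_distrib[symmetric] divide_self less_imp_neq[symmetric] not_False_eq_True
          divide_nonneg_pos)+
    have zD: "z \<in> D"
      unfolding z_def using convex_on_imp_convex[OF g] x(1) y(1) S by (intro convexD) auto
    have "g z \<le> (g y + \<epsilon>) / S * g x + - g x / S * g y"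
      unfolding z_def using g S x y unfolding convex_on_def by blast
    also have "\<dots> = \<epsilon> * g x / S" by (simp add: field_simps add_divide_distrib)
    also have "\<dots> < 0" using \<epsilon> x S by (simp add: divide_neg_pos mult_pos_neg)
    finally have "f z \<le> 0" using neg zD by auto
    moreover have "(g y + \<epsilon>) / S * f x + - g x / S * f y \<le> f z"
      unfolding z_def using f S x y unfolding concave_on_iff by blast
    moreover have "(g y + \<epsilon>) / S * f x + - g x / S * f y = ((g y + \<epsilon>) * f x - g x * f y) / S"
      by (simp add: diff_divide_distrib)
    ultimately have "((g y + \<epsilon>) * f x - g x * f y) / S \<le> 0" by linarith
    then have "(g y + \<epsilon>) * f x - g x * f y \<le> 0" using S by (simp add: divide_le_0_iff)
    then show "g y * f x \<le> g x * f y + e" using \<epsilon> by (simp add: algebra_simps)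
  qed
  define R where "R = (\<lambda>x. f x / g x) ` {x \<in> D. g x < 0}"
  have R0: "0 \<le> r" if "r \<in> R" for r
    using that neg by (auto simp: R_def intro: divide_nonpos_neg)
  have bdd: "bdd_below R" by (rule bdd_belowI) (rule R0)
  have ne: "R \<noteq> {}" using x0 by (auto simp: R_def)
  show thesis
  proof (rule that[of "Inf R"])
    show "Inf R \<ge> 0" using ne R0 by (intro cInf_greatest) auto
    fix y assume y: "y \<in> D"
    consider "g y < 0" | "g y = 0" | "g y > 0" by linarith
    then show "f y \<le> Inf R * g y"
    proof cases
      case 1
      then have "Inf R \<le> f y / g y" using y by (intro cInf_lower bdd) (auto simp: R_def)
      then show ?thesis using 1 by (simp add: neg_le_divide_eq)
    next
      case 2
      then show ?thesis using cross[OF x0 y] x0 by (simp add: zero_le_mult_iff)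
    next
      case 3
      have "f y / g y \<le> Inf R"
      proof (rule cInf_greatest[OF ne])
        fix r assume "r \<in> R"
        then obtain x where x: "x \<in> D" "g x < 0" "r = f x / g x" by (auto simp: R_def)
        have "g y * f x \<le> g x * f y" using cross x y 3 by auto
        then have "g x * (r * g y) \<le> g x * f y" using x by (simp add: algebra_simps)
        then have "f y \<le> r * g y" using x(2) by (simp add: mult_le_cancel_left)
        then show "f y / g y \<le> r" using 3 by (simp add: pos_divide_le_eq)
      qed
      then show ?thesis using 3 by (simp add: pos_divide_le_eq)
    qed
  qed
qed

section \<open>Entropy of probability sequences with finite mean\<close>

text \<open>
  The tangent inequality of the convex function $y \ln y$, in the form that also covers $y = 0$. It is
  the common source of the entropy estimates.
\<close>

lemma mult_ln_le:
  fixes x y :: real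
  assumes "x > 0" "y \<ge> 0"
  shows "y * ln x \<le> y * ln y - y + x"
proof (cases "y = 0")
  case False
  then have y: "y > 0" using assms by simp
  have "ln (x / y) \<le> x / y - 1" using assms y by (intro ln_le_minus_one) auto
  then have "y * (ln x - ln y) \<le> y * (x / y - 1)"
    using assms y by (intro mult_left_mono) (auto simp: ln_div)
  then show ?thesis using y by (simp add: algebra_simps)
qed (use assms in auto)

text \<open>
  The negative part of $t \ln t$ is controlled by the mean up to a summable term; the freedom in
  $\kappa$ allows the mean to enter with an arbitrarily small factor.
\<close>

lemma xlnx_ge:
  fixes t \<kappa> :: real
  assumes "t \<ge> 0"
  shows "- (\<kappa> * n * t) - exp (- \<kappa> * n) \<le> t * ln t"
  using mult_ln_le[of "exp (- \<kappa> * n)" t] assms by (simp add: algebra_simps)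

lemma summable_exp_mult_nat: 
  assumes "\<kappa> > 0"
  shows "summable (\<lambda>n. exp (- \<kappa> * real n))"
  using summable_geometric[of "exp (- \<kappa>)"] assms
  by (simp add: exp_of_nat_mult[symmetric] mult.commute)

lemma S_tilde_le_one:
  assumes "t \<in> S_tilde"
  shows "t n \<le> 1"
proof -
  have "sum t {n} \<le> suminf t"
    using assms by (intro sum_le_suminf) (auto simp: S_tilde_def sums_iff)
  then show ?thesis using assms by (simp add: S_tilde_def sums_iff)
qed

lemma S_tilde_in_l_one: "t \<in> S_tilde \<Longrightarrow> t \<in> l_one"
  by (auto simp: S_tilde_def l_one_def sums_iff)

lemma summable_xlnx:
  fixes t :: "nat \<Rightarrow> real"
  assumes t: "\<And>n. 0 \<le> t n" "\<And>n. t n \<le> 1" and mean: "summable (\<lambda>n. real n * t n)"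
  shows "summable (\<lambda>n. t n * ln (t n))"
proof (rule summable_comparison_test')
  show "summable (\<lambda>n. real n * t n + exp (- 1 * real n))"
    by (intro summable_add mean summable_exp_mult_nat) simp
  fix n
  have "t n * ln (t n) \<le> 0"
    using t[of n] by (cases "t n = 0") (auto intro: mult_nonneg_nonpos)
  then show "norm (t n * ln (t n)) \<le> real n * t n + exp (- 1 * real n)"
    using xlnx_ge[of "t n" 1 "real n"] t(1)[of n] by simp
qed

lemma summable_S_tilde_xlnx: "t \<in> S_tilde \<Longrightarrow> summable (\<lambda>n. t n * ln (t n))"
  using S_tilde_le_one by (intro summable_xlnx) (auto simp: S_tilde_def)

lemma mean_nonneg: "t \<in> S_tilde \<Longrightarrow> 0 \<le> mean t"
  by (auto simp: S_tilde_def mean_def intro: suminf_nonneg)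

lemma mean_pos:
  assumes t: "t \<in> S_tilde" "t \<noteq> e_zero"
  shows "0 < mean t"
proof (rule ccontr)
  assume "\<not> 0 < mean t"
  then have "mean t = 0" using mean_nonneg[OF t(1)] by simp
  then have z: "real n * t n = 0" for n
    using t(1) by (auto simp: S_tilde_def mean_def suminf_eq_zero_iff)
  then have "t n = 0" if "n \<noteq> 0" for n using that by (metis mult_eq_0_iff of_nat_eq_0_iff)
  moreover from this have "t sums t 0" using sums_finite[of "{0}" t] by auto
  then have "t 0 = 1" using t(1) by (auto simp: S_tilde_def dest: sums_unique2)
  ultimately have "t = e_zero" by (auto simp: e_zero_def)
  with t show False by simp
qed

lemma mean_pos_imp_ne_e_zero: "0 < mean t \<Longrightarrow> t \<noteq> e_zero"
proof
  assume "0 < mean t" "t = e_zero"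
  moreover have "(\<lambda>n. real n * e_zero n) = (\<lambda>n. 0)" by (auto simp: e_zero_def)
  ultimately show False by (simp add: mean_def)
qed

lemma summable_l_infty_times_l_one:
  assumes "c \<in> l_infty" "t \<in> l_one"
  shows "summable (\<lambda>n. c n * t n)"
proof -
  obtain B where "\<And>n. \<bar>c n\<bar> \<le> B" using assms by (auto simp: l_infty_def bounded_iff)
  then have "norm (c n * t n) \<le> B * \<bar>t n\<bar>" for n
    by (simp add: abs_mult mult_right_mono)
  moreover have "summable (\<lambda>n. B * \<bar>t n\<bar>)"
    using assms by (intro summable_mult) (simp add: l_one_def)
  ultimately show ?thesis by (rule summable_comparison_test'[rotated])
qed

lemma summable_exp_bounded_plus_linear:
  assumes c: "c \<in> l_infty" and l: "l < 0"
  shows "summable (\<lambda>n. exp (c n + real n * l))"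
proof -
  obtain B where B: "\<And>n. \<bar>c n\<bar> \<le> B" using c by (auto simp: l_infty_def bounded_iff)
  then have B': "c n \<le> B" for n by (rule abs_le_D1)
  show ?thesis
  proof (rule summable_comparison_test')
    show "summable (\<lambda>n. exp B * exp (- (- l) * real n))"
      using l by (intro summable_mult summable_exp_mult_nat) auto
    show "norm (exp (c n + real n * l)) \<le> exp B * exp (- (- l) * real n)" for n
      using B'[of n] by (simp add: exp_add[symmetric] mult.commute)
  qed
qed

text \<open>
  Nonnegativity of the relative entropy of $t$ with respect to the probability sequence that is
  proportional to $e^{c_n + n l}$.
\<close>

lemma gibbs_inequality:
  assumes t: "t \<in> S_tilde" and c: "c \<in> l_infty" and l: "l < 0"
  shows "(\<Sum>n. c n * t n) + l * mean t - ln (\<Sum>n. exp (c n + real n * l)) \<le> (\<Sum>n. t n * ln (t n))"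
proof -
  define Z where "Z = (\<Sum>n. exp (c n + real n * l))"
  have sZ: "summable (\<lambda>n. exp (c n + real n * l))"
    by (rule summable_exp_bounded_plus_linear[OF c l])
  have Z: "Z > 0" unfolding Z_def by (rule suminf_pos[OF sZ]) auto
  have t0: "t n \<ge> 0" for n using t by (simp add: S_tilde_def)
  have st: "(\<lambda>n. t n) sums 1" "summable (\<lambda>n. real n * t n)" using t by (auto simp: S_tilde_def)
  have "(\<lambda>n. c n * t n + l * (real n * t n) - ln Z * t n) sums ((\<Sum>n. c n * t n) + l * mean t - ln Z * 1)"
    unfolding mean_def
    by (rule sums_diff[OF sums_add[OF summable_sums sums_mult[OF summable_sums]] sums_mult])
      (fact summable_l_infty_times_l_one[OF c S_tilde_in_l_one[OF t]] st)+
  moreover have "(\<lambda>n. t n * ln (t n) - t n + exp (c n + real n * l) / Z) sums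
      ((\<Sum>n. t n * ln (t n)) - 1 + Z / Z)"
    unfolding Z_def
    by (rule sums_add[OF sums_diff[OF summable_sums] sums_divide[OF summable_sums]])
      (fact summable_S_tilde_xlnx[OF t] st sZ)+
  moreover have "c n * t n + l * (real n * t n) - ln Z * t n \<le> t n * ln (t n) - t n + exp (c n + real n * l) / Z" for n
  proof -
    define w where "w = exp (c n + real n * l) / Z"
    have "w > 0" "ln w = c n + real n * l - ln Z" using Z by (simp_all add: w_def ln_div)
    then have "t n * (c n + real n * l - ln Z) \<le> t n * ln (t n) - t n + w"
      using mult_ln_le[of w "t n"] t0[of n] by simp
    then show ?thesis unfolding w_def[symmetric] by (simp add: algebra_simps)
  qed
  ultimately have "(\<Sum>n. c n * t n) + l * mean t - ln Z * 1 \<le> (\<Sum>n. t n * ln (t n)) - 1 + Z / Z"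
    by (rule sums_le[rotated])
  then show ?thesis using Z by (simp add: Z_def)
qed

text \<open>
  The mixture of $t$ with the point mass at $N$. For large $N$ it adjusts the mean at small cost in $l_1$.
\<close>

definition mix_point :: "real \<Rightarrow> nat \<Rightarrow> (nat \<Rightarrow> real) \<Rightarrow> nat \<Rightarrow> real" where
  "mix_point \<delta> N t = (\<lambda>n. (1 - \<delta>) * t n + (if n = N then \<delta> else 0))"

lemma mix_point_S_tilde:
  assumes t: "t \<in> S_tilde" and \<delta>: "0 \<le> \<delta>" "\<delta> \<le> 1"
  shows "mix_point \<delta> N t \<in> S_tilde"
    and "mean (mix_point \<delta> N t) = (1 - \<delta>) * mean t + \<delta> * N"
proof -
  have "(\<lambda>n. (1 - \<delta>) * t n + (if n = N then \<delta> else 0)) sums ((1 - \<delta>) * 1 + \<delta>)"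
    using t by (intro sums_add sums_mult sums_single) (auto simp: S_tilde_def)
  then have one: "mix_point \<delta> N t sums 1" by (simp add: mix_point_def)
  have "(\<lambda>n. (1 - \<delta>) * (real n * t n) + (if n = N then \<delta> * real n else 0)) sums ((1 - \<delta>) * mean t + \<delta> * N)"
    using t unfolding mean_def
    by (intro sums_add[OF sums_mult[OF summable_sums] sums_single]) (simp add: S_tilde_def)
  moreover have "(\<lambda>n. (1 - \<delta>) * (real n * t n) + (if n = N then \<delta> * real n else 0)) = (\<lambda>n. real n * mix_point \<delta> N t n)"
    by (auto simp: mix_point_def fun_eq_iff algebra_simps)
  ultimately have m: "(\<lambda>n. real n * mix_point \<delta> N t n) sums ((1 - \<delta>) * mean t + \<delta> * N)" by simp
  then show "mean (mix_point \<delta> N t) = (1 - \<delta>) * mean t + \<delta> * N"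
    by (simp add: mean_def sums_iff)
  show "mix_point \<delta> N t \<in> S_tilde"
    using one m t \<delta> by (auto simp: S_tilde_def sums_iff mix_point_def)
qed

text \<open>Convexity of $x \ln x$ between $t$ and $e$, where $e \ln e = 0$ for both admissible values of $e$.\<close>

lemma mix_point_xlnx_le:
  fixes t :: real
  assumes t: "0 \<le> t" "t \<le> 1" and \<delta>: "0 \<le> \<delta>" "\<delta> \<le> 1" and e: "e = 0 \<or> e = 1"
  shows "((1 - \<delta>) * t + \<delta> * e) * ln ((1 - \<delta>) * t + \<delta> * e) \<le> (1 - \<delta>) * (t * ln t)"
proof (cases "(1 - \<delta>) * t + \<delta> * e = 0")
  case True
  have "(1 - \<delta>) * t \<ge> 0" "\<delta> * e \<ge> 0" using t \<delta> e by auto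
  then have "(1 - \<delta>) * t = 0" using True by linarith
  then show ?thesis using True by (metis mult_zero_left mult.assoc order_refl)
next
  case False
  define x where "x = (1 - \<delta>) * t + \<delta> * e"
  have "x \<ge> 0" using t \<delta> e by (auto simp: x_def)
  then have x: "x > 0" using False by (simp add: x_def)
  have "(1 - \<delta>) * (t * ln x) \<le> (1 - \<delta>) * (t * ln t - t + x)"
    using mult_ln_le[OF x t(1)] \<delta> by (intro mult_left_mono) auto
  moreover have "\<delta> * (e * ln x) \<le> \<delta> * (e * ln e - e + x)"
    using mult_ln_le[OF x, of e] e \<delta> by (intro mult_left_mono) auto
  moreover have "e * ln e = 0" using e by auto
  ultimately have "x * ln x \<le> (1 - \<delta>) * (t * ln t)"
    by (simp add: x_def algebra_simps)
  then show ?thesis by (simp add: x_def)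
qed

lemma mix_point_entropy_le:
  assumes t: "t \<in> S_tilde" and \<delta>: "0 \<le> \<delta>" "\<delta> \<le> 1"
  shows "(\<Sum>n. mix_point \<delta> N t n * ln (mix_point \<delta> N t n)) \<le> (1 - \<delta>) * (\<Sum>n. t n * ln (t n))"
proof -
  have s: "summable (\<lambda>n. t n * ln (t n))" by (rule summable_S_tilde_xlnx[OF t])
  have "(\<Sum>n. mix_point \<delta> N t n * ln (mix_point \<delta> N t n)) \<le> (\<Sum>n. (1 - \<delta>) * (t n * ln (t n)))"
  proof (rule suminf_le)
    show "summable (\<lambda>n. mix_point \<delta> N t n * ln (mix_point \<delta> N t n))"
      by (rule summable_S_tilde_xlnx[OF mix_point_S_tilde(1)[OF t \<delta>]])
    show "summable (\<lambda>n. (1 - \<delta>) * (t n * ln (t n)))" by (rule summable_mult[OF s])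
    show "mix_point \<delta> N t n * ln (mix_point \<delta> N t n) \<le> (1 - \<delta>) * (t n * ln (t n))" for n
      using mix_point_xlnx_le[of "t n" \<delta> "if n = N then 1 else 0"] S_tilde_le_one[OF t, of n] t \<delta>
      by (auto simp: mix_point_def S_tilde_def)
  qed
  then show ?thesis by (simp add: suminf_mult[OF s])
qed

lemma l_one_dist_mix_point_le:
  assumes t: "t \<in> S_tilde" and \<delta>: "0 \<le> \<delta>" "\<delta> \<le> 1"
  shows "l_one_dist (mix_point \<delta> N t) t \<le> 2 * \<delta>"
proof -
  have l1: "mix_point \<delta> N t \<in> l_one" "t \<in> l_one"
    using mix_point_S_tilde(1)[OF t \<delta>] t by (auto intro: S_tilde_in_l_one)
  have "(\<lambda>n. \<bar>mix_point \<delta> N t n - t n\<bar>) sums l_one_dist (mix_point \<delta> N t) t"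
    using l1 l_one_diff[OF l1] by (simp add: l_one_dist_def summable_sums)
  moreover have "(\<lambda>n. \<delta> * t n + (if n = N then \<delta> else 0)) sums (\<delta> * 1 + \<delta>)"
    using t by (intro sums_add sums_mult sums_single) (auto simp: S_tilde_def)
  moreover have "\<bar>mix_point \<delta> N t n - t n\<bar> \<le> \<delta> * t n + (if n = N then \<delta> else 0)" for n
  proof -
    have "\<delta> * t n \<ge> 0" using t \<delta> by (auto simp: S_tilde_def)
    then show ?thesis using \<delta> by (auto simp: mix_point_def algebra_simps)
  qed
  ultimately have "l_one_dist (mix_point \<delta> N t) t \<le> \<delta> * 1 + \<delta>" by (rule sums_le[rotated])
  then show ?thesis by simp
qed

section \<open>Test sequences in the conjugate\<close>

lemma finite_support_in_l_infty:
  assumes "\<And>n. n \<ge> N \<Longrightarrow> c n = 0"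
  shows "c \<in> l_infty"
proof -
  have "range c \<subseteq> insert 0 (c ` {..<N})"
  proof
    fix x assume "x \<in> range c"
    then obtain n where "x = c n" by auto
    then show "x \<in> insert 0 (c ` {..<N})" using assms[of n] by (cases "n < N") auto
  qed
  then have "finite (range c)" by (rule finite_subset) simp
  then show ?thesis by (simp add: l_infty_def finite_imp_bounded)
qed

lemma const_l_infty: "(\<lambda>n. k) \<in> l_infty"
  by (simp add: l_infty_def image_constant_conv)

text \<open>
  These bounds are those that a finite value of the conjugate imposes for one fixed $\varphi$, with
  $l = \lambda(\varphi)$ and $\mu(\varphi)$ absorbed into $B$. Suitable bounded sequences $c$ extract from them that
  $t$ is a probability sequence with finite mean, together with the entropy inequality.
\<close>

context
  fixes t :: "nat \<Rightarrow> real" and l B :: real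
  assumes t: "t \<in> l_one" and l: "l < 0"
    and bound: "\<And>c. c \<in> l_infty \<Longrightarrow> (\<Sum>n. c n * t n) - ln (\<Sum>n. exp (c n + real n * l)) \<le> B"
begin

lemma geometric_weights_sums: "(\<lambda>n. exp (real n * l)) sums (\<Sum>n. exp (real n * l))"
  using summable_exp_bounded_plus_linear[OF const_l_infty[of 0] l] by (simp add: summable_sums)

lemma geometric_weights_pos: "(\<Sum>n. exp (real n * l)) > 0"
  using geometric_weights_sums by (intro suminf_pos) (auto simp: sums_iff)

text \<open>
  Lowering $c_k$ can only decrease the partition function, so the bound would fail for large $K$ if $t_k$
  were negative.
\<close>

lemma nonneg_of_conjugate_bounded: "0 \<le> t k"
proof (rule ccontr)
  assume "\<not> 0 \<le> t k"
  then have neg: "t k < 0" by simp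
  define z where "z = ln (\<Sum>n. exp (real n * l))"
  define K where "K = (\<bar>B + z\<bar> + 1) / (- t k)"
  have K: "K \<ge> 0" using neg by (auto simp: K_def intro!: divide_nonneg_neg)
  define c where "c = (\<lambda>n. if n = k then - K else 0)"
  have c: "c \<in> l_infty" by (rule finite_support_in_l_infty[of "Suc k"]) (simp add: c_def)
  have "(\<lambda>n. if n = k then - K * t n else 0) sums (- K * t k)" by (rule sums_single)
  moreover have "(\<lambda>n. if n = k then - K * t n else 0) = (\<lambda>n. c n * t n)" by (auto simp: c_def)
  ultimately have ct: "(\<Sum>n. c n * t n) = - K * t k" by (simp add: sums_iff)
  have s: "summable (\<lambda>n. exp (c n + real n * l))" by (rule summable_exp_bounded_plus_linear[OF c l])
  have "(\<Sum>n. exp (c n + real n * l)) \<le> (\<Sum>n. exp (real n * l))"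
    using s geometric_weights_sums K by (intro suminf_le) (auto simp: c_def sums_iff)
  moreover have "(\<Sum>n. exp (c n + real n * l)) > 0" by (rule suminf_pos[OF s]) simp
  ultimately have "ln (\<Sum>n. exp (c n + real n * l)) \<le> z" unfolding z_def by simp
  then have "- K * t k \<le> B + z" using bound[OF c] ct by linarith
  moreover have "- K * t k = \<bar>B + z\<bar> + 1" using neg by (simp add: K_def)
  ultimately show False by linarith
qed

text \<open>
  A constant $c = k$ shifts the logarithm of the partition function by exactly $k$, so $k (\sum t_n - 1)$
  is bounded above for all real $k$.
\<close>

lemma total_one_of_conjugate_bounded: "t sums 1"
proof -
  define T where "T = suminf t"
  have T: "t sums T"
    using t by (auto simp: l_one_def T_def intro!: summable_sums summable_rabs_cancel)
  define z where "z = ln (\<Sum>n. exp (real n * l))"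
  have le: "k * (T - 1) \<le> B + z" for k
  proof -
    have "(\<lambda>n. exp k * exp (real n * l)) sums (exp k * (\<Sum>n. exp (real n * l)))"
      by (rule sums_mult[OF geometric_weights_sums])
    then have "(\<Sum>n. exp (k + real n * l)) = exp k * (\<Sum>n. exp (real n * l))"
      by (simp add: exp_add sums_iff)
    then have "ln (\<Sum>n. exp (k + real n * l)) = k + z"
      using geometric_weights_pos by (simp add: ln_mult z_def)
    moreover have "(\<Sum>n. k * t n) = k * T" using sums_mult[OF T, of k] by (simp add: sums_iff)
    ultimately show ?thesis using bound[OF const_l_infty[of k]] by (simp add: algebra_simps)
  qed
  have "T = 1"
  proof (rule ccontr)
    assume "T \<noteq> 1"
    then show False using le[of "(\<bar>B + z\<bar> + 1) / (T - 1)"] by simp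
  qed
  then show ?thesis using T by simp
qed

text \<open>
  The optimal choice would be $c_n = \ln t_n - n l$, which need not be bounded and is undefined at
  $t_n = 0$. It is therefore cut off at $N$, and $t_n$ is replaced by its maximum with $e^{N l} e^{n l}$.
  Both changes raise the partition function above $1$ by at most a multiple of $e^{N l}$, which vanishes as
  $N$ grows.
\<close>

lemma partial_entropy_le:
  "(\<Sum>n<N. t n * ln (t n)) - l * (\<Sum>n<N. real n * t n)
    \<le> B + 2 * (\<Sum>n. exp (real n * l)) * exp (real N * l)"
proof -
  define G where "G = (\<Sum>n. exp (real n * l))"
  define q where "q = exp (real N * l)"
  have q: "q > 0" by (simp add: q_def)
  have G: "(\<lambda>n. exp (real n * l)) sums G" "G > 0"
    using geometric_weights_sums geometric_weights_pos by (auto simp: G_def)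
  have t0: "t n \<ge> 0" for n by (rule nonneg_of_conjugate_bounded)
  define w where "w = (\<lambda>n. max (t n) (q * exp (real n * l)))"
  have w: "w n > 0" "t n \<le> w n" "w n \<le> t n + q * exp (real n * l)" for n
    using q t0[of n] by (auto simp: w_def less_max_iff_disj)
  define c where "c = (\<lambda>n. if n < N then ln (w n) - real n * l else 0)"
  have c: "c \<in> l_infty" by (rule finite_support_in_l_infty[of N]) (simp add: c_def)
  have "(\<Sum>n. c n * t n) = (\<Sum>n<N. c n * t n)"
    by (rule suminf_finite) (auto simp: c_def)
  moreover have "(\<Sum>n<N. t n * ln (t n) - l * (real n * t n)) \<le> (\<Sum>n<N. c n * t n)"
  proof (rule sum_mono)
    fix n assume "n \<in> {..<N}"
    then have n: "c n = ln (w n) - real n * l" by (simp add: c_def)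
    have "t n * ln (t n) \<le> t n * ln (w n)"
      using t0[of n] w(1,2)[of n] by (cases "t n = 0") (auto intro!: mult_left_mono)
    then show "t n * ln (t n) - l * (real n * t n) \<le> c n * t n"
      by (simp add: n algebra_simps)
  qed
  ultimately have lower: "(\<Sum>n<N. t n * ln (t n)) - l * (\<Sum>n<N. real n * t n) \<le> (\<Sum>n. c n * t n)"
    by (simp add: sum_subtractf sum_distrib_left)
  define d where "d = (\<lambda>n. if n < N then 0 else exp (real n * l))"
  have "(\<lambda>n. q * exp (real n * l)) sums (q * G)" by (rule sums_mult[OF G(1)])
  then have "(\<lambda>n. d (n + N)) sums (q * G)"
    by (simp add: d_def q_def exp_add[symmetric] distrib_right add.commute)
  then have "d sums (q * G + (\<Sum>n<N. d n))" by (simp only: sums_iff_shift)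
  then have d: "d sums (q * G)" by (simp add: d_def)
  have s: "summable (\<lambda>n. exp (c n + real n * l))" by (rule summable_exp_bounded_plus_linear[OF c l])
  have "exp (c n + real n * l) \<le> t n + q * exp (real n * l) + d n" for n
  proof (cases "n < N")
    case True
    then show ?thesis using w[of n] by (simp add: c_def d_def)
  next
    case False
    then show ?thesis using t0[of n] q by (simp add: c_def d_def)
  qed
  moreover have "(\<lambda>n. t n + q * exp (real n * l) + d n) sums (1 + q * G + q * G)"
    by (intro sums_add sums_mult total_one_of_conjugate_bounded G(1) d)
  ultimately have "(\<Sum>n. exp (c n + real n * l)) \<le> 1 + q * G + q * G"
    by (rule sums_le[OF _ summable_sums[OF s]])
  moreover have "(\<Sum>n. exp (c n + real n * l)) > 0" by (rule suminf_pos[OF s]) simp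
  ultimately have "ln (\<Sum>n. exp (c n + real n * l)) \<le> ln (1 + 2 * G * q)"
    by (simp add: algebra_simps)
  also have "\<dots> \<le> 2 * G * q" using G q by (intro ln_add_one_self_le_self) simp
  finally have "ln (\<Sum>n. exp (c n + real n * l)) \<le> 2 * G * q" .
  then show ?thesis using lower bound[OF c] unfolding G_def q_def by linarith
qed

text \<open>
  Half of the term $- l \sum n t_n$ suffices to absorb the negative part of the entropy; the other half
  then bounds the partial sums of the mean.
\<close>

lemma S_tilde_of_conjugate_bounded: "t \<in> S_tilde"
proof -
  define G where "G = (\<Sum>n. exp (real n * l))"
  define \<kappa> where "\<kappa> = - l / 2"
  define C where "C = (\<Sum>n. exp (- \<kappa> * real n))"
  have \<kappa>: "\<kappa> > 0" using l by (simp add: \<kappa>_def)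
  have t0: "t n \<ge> 0" for n by (rule nonneg_of_conjugate_bounded)
  have "summable (\<lambda>n. real n * t n)"
  proof (rule summableI_nonneg_bounded)
    fix N
    have "(\<Sum>n<N. exp (- \<kappa> * real n)) \<le> C"
      unfolding C_def by (rule sum_le_suminf[OF summable_exp_mult_nat[OF \<kappa>]]) auto
    moreover have "(\<Sum>n<N. - (\<kappa> * real n * t n) - exp (- \<kappa> * real n)) \<le> (\<Sum>n<N. t n * ln (t n))"
      by (intro sum_mono xlnx_ge t0)
    then have "- \<kappa> * (\<Sum>n<N. real n * t n) - (\<Sum>n<N. exp (- \<kappa> * real n)) \<le> (\<Sum>n<N. t n * ln (t n))"
      by (simp add: sum_subtractf sum_negf sum_distrib_left mult.assoc)
    moreover have "2 * G * exp (real N * l) \<le> 2 * G * 1"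
      using l geometric_weights_pos
      by (intro mult_left_mono) (auto simp: G_def mult_nonneg_nonpos)
    ultimately have "\<kappa> * (\<Sum>n<N. real n * t n) \<le> B + 2 * G + C"
      using partial_entropy_le[of N] unfolding \<kappa>_def G_def by linarith
    then show "(\<Sum>n<N. real n * t n) \<le> (B + 2 * G + C) / \<kappa>"
      using \<kappa> by (simp add: pos_le_divide_eq mult.commute)
  qed (use t0 in auto)
  then show ?thesis using t0 total_one_of_conjugate_bounded by (simp add: S_tilde_def)
qed

lemma entropy_le_of_conjugate_bounded: "(\<Sum>n. t n * ln (t n)) - l * mean t \<le> B"
proof (rule LIMSEQ_le)
  have t': "t \<in> S_tilde" by (rule S_tilde_of_conjugate_bounded)
  show "(\<lambda>N. (\<Sum>n<N. t n * ln (t n)) - l * (\<Sum>n<N. real n * t n)) \<longlonglongrightarrow> (\<Sum>n. t n * ln (t n)) - l * mean t"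
    unfolding mean_def using t' summable_S_tilde_xlnx[OF t']
    by (intro tendsto_diff tendsto_mult tendsto_const summable_LIMSEQ) (auto simp: S_tilde_def)
  have "(\<lambda>N. exp (real N * l)) \<longlonglongrightarrow> 0"
    using geometric_weights_sums by (intro summable_LIMSEQ_zero) (auto simp: sums_iff)
  then have "(\<lambda>N. B + 2 * (\<Sum>n. exp (real n * l)) * exp (real N * l)) \<longlonglongrightarrow> B + 2 * (\<Sum>n. exp (real n * l)) * 0"
    by (intro tendsto_intros)
  then show "(\<lambda>N. B + 2 * (\<Sum>n. exp (real n * l)) * exp (real N * l)) \<longlonglongrightarrow> B" by simp
  show "\<exists>N. \<forall>n\<ge>N. (\<Sum>n<n. t n * ln (t n)) - l * (\<Sum>n<n. real n * t n)
      \<le> B + 2 * (\<Sum>n. exp (real n * l)) * exp (real n * l)"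
    using partial_entropy_le by blast
qed

end

section \<open>Semicontinuity of the conjugate and its comparison with the entropy functional\<close>

definition effective_domain :: "('a \<Rightarrow> ereal) \<Rightarrow> 'a set" where
  "effective_domain lam = {\<phi>. lam \<phi> < \<infinity>}"

lemma lam_hat_conjugate_le_iff:
  "lam_hat_conjugate lam (t, \<mu>) \<le> a \<longleftrightarrow>
    (\<forall>c\<in>l_infty. \<forall>\<phi>\<in>neg_set lam.
      ereal ((\<Sum>n. c n * t n) + \<mu> \<phi> - ln (\<Sum>n. exp (c n + real n * real_of_ereal (lam \<phi>)))) \<le> a)"
proof -
  have "lam_hat_conjugate lam (t, \<mu>) \<le> a \<longleftrightarrow>
    (\<forall>c\<in>l_infty. \<forall>\<phi>. ereal ((\<Sum>n. c n * t n) + \<mu> \<phi>) - lam_hat lam (c, \<phi>) \<le> a)"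
    by (auto simp: lam_hat_conjugate_def SUP_le_iff)
  also have "\<dots> \<longleftrightarrow> (\<forall>c\<in>l_infty. \<forall>\<phi>\<in>neg_set lam.
      ereal ((\<Sum>n. c n * t n) + \<mu> \<phi> - ln (\<Sum>n. exp (c n + real n * real_of_ereal (lam \<phi>)))) \<le> a)"
    by (intro ball_cong refl) (auto simp: lam_hat_def)
  finally show ?thesis .
qed

lemma continuous_map_l_one_pairing:
  assumes c: "c \<in> l_infty"
  shows "continuous_map l_one_topology euclideanreal (\<lambda>t. \<Sum>n. c n * t n)"
proof -
  interpret Metric_space l_one l_one_dist by (rule Metric_space_l_one)
  obtain K where K: "\<And>n. \<bar>c n\<bar> \<le> K" using c by (auto simp: l_infty_def bounded_iff)
  have K0: "K \<ge> 0" using K[of 0] by linarith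
  have lip: "\<bar>(\<Sum>n. c n * s n) - (\<Sum>n. c n * t n)\<bar> \<le> K * l_one_dist s t"
    if st: "s \<in> l_one" "t \<in> l_one" for s t
  proof -
    have sd: "summable (\<lambda>n. K * \<bar>s n - t n\<bar>)" by (intro summable_mult l_one_diff st)
    have le: "\<bar>c n * (s n - t n)\<bar> \<le> K * \<bar>s n - t n\<bar>" for n
      using K by (simp add: abs_mult mult_right_mono)
    have sa: "summable (\<lambda>n. \<bar>c n * (s n - t n)\<bar>)"
      by (rule summable_comparison_test'[OF sd]) (use le in auto)
    have "(\<Sum>n. c n * s n) - (\<Sum>n. c n * t n) = (\<Sum>n. c n * (s n - t n))"
      using suminf_diff[OF summable_l_infty_times_l_one[OF c st(1)] summable_l_infty_times_l_one[OF c st(2)]]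
      by (simp add: algebra_simps)
    also have "\<bar>\<dots>\<bar> \<le> (\<Sum>n. \<bar>c n * (s n - t n)\<bar>)" by (rule summable_rabs[OF sa])
    also have "\<dots> \<le> (\<Sum>n. K * \<bar>s n - t n\<bar>)" by (rule suminf_le[OF le sa sd])
    also have "\<dots> = K * l_one_dist s t"
      using st by (simp add: l_one_dist_def suminf_mult l_one_diff)
    finally show ?thesis .
  qed
  have "continuous_map mtopology Met_TC.mtopology (\<lambda>t. \<Sum>n. c n * t n)"
    unfolding metric_continuous_map[OF Met_TC.Metric_space_axioms]
  proof (intro conjI ballI allI impI)
    fix s and e :: real assume s: "s \<in> l_one" and e: "e > 0"
    have "dist (\<Sum>n. c n * s n) (\<Sum>n. c n * x n) < e"
      if x: "x \<in> l_one" "l_one_dist s x < e / (K + 1)" for x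
    proof -
      have "K * l_one_dist s x \<le> (K + 1) * l_one_dist s x" by (simp add: distrib_right)
      also have "\<dots> < e" using x K0 by (simp add: pos_less_divide_eq mult.commute)
      finally show ?thesis using lip[OF s x(1)] by (simp add: dist_real_def)
    qed
    moreover have "e / (K + 1) > 0" using e K0 by simp
    ultimately show "\<exists>\<delta>>0. \<forall>x. x \<in> l_one \<and> l_one_dist s x < \<delta> \<longrightarrow> dist (\<Sum>n. c n * s n) (\<Sum>n. c n * x n) < e"
      by blast
  qed auto
  then show ?thesis by (simp add: l_one_topology_def)
qed

lemma continuous_map_weak_star_eval:
  "continuous_map weak_star_topology euclideanreal (\<lambda>\<mu>. \<mu> \<phi>)"
  unfolding weak_star_topology_def
  by (intro continuous_map_from_subtopology continuous_map_product_projection) simp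

lemma lam_hat_conjugate_lsc:
  assumes ne: "neg_set lam \<noteq> {}"
  shows "lower_semicontinuous (prod_topology l_one_topology weak_star_topology) (lam_hat_conjugate lam)"
  unfolding lower_semicontinuous_def
proof
  fix a
  let ?X = "prod_topology l_one_topology weak_star_topology"
  let ?F = "\<lambda>(c, \<phi>) (t, \<mu>). (\<Sum>n. c n * t n) + \<mu> \<phi> - ln (\<Sum>n. exp (c n + real n * real_of_ereal (lam \<phi>)))"
  have closed: "closedin ?X {x \<in> topspace ?X. ereal (?F (c, \<phi>) x) \<le> a}" if "c \<in> l_infty" for c \<phi>
  proof -
    have "continuous_map ?X euclideanreal (\<lambda>x. (\<lambda>t. \<Sum>n. c n * t n) (fst x) + (\<lambda>\<mu>. \<mu> \<phi>) (snd x)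
        - ln (\<Sum>n. exp (c n + real n * real_of_ereal (lam \<phi>))))"
      using continuous_map_compose[OF continuous_map_fst continuous_map_l_one_pairing[OF that], unfolded comp_def]
        continuous_map_compose[OF continuous_map_snd continuous_map_weak_star_eval, unfolded comp_def]
      by (intro continuous_map_diff continuous_map_add) auto
    then have "continuous_map ?X euclideanreal (?F (c, \<phi>))" by (simp add: case_prod_unfold)
    moreover have "closedin euclideanreal {y. ereal y \<le> a}"
      unfolding closed_closedin[symmetric] by (intro closed_Collect_le continuous_intros)
    ultimately show ?thesis
      using closedin_continuous_map_preimage by fastforce
  qed
  have "{x \<in> topspace ?X. lam_hat_conjugate lam x \<le> a}
      = (\<Inter>(c, \<phi>)\<in>l_infty \<times> neg_set lam. {x \<in> topspace ?X. ereal (?F (c, \<phi>) x) \<le> a})"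
    using ne const_l_infty by (fastforce simp: lam_hat_conjugate_le_iff)
  moreover have "closedin ?X \<dots>"
    using ne const_l_infty closed by (intro closedin_INT) auto
  ultimately show "closedin ?X {x \<in> topspace ?X. lam_hat_conjugate lam x \<le> a}" by simp
qed

lemma real_of_neg_set:
  assumes "lam \<phi> \<noteq> -\<infinity>" "\<phi> \<in> neg_set lam"
  shows "real_of_ereal (lam \<phi>) < 0" "\<phi> \<in> effective_domain lam"
  using assms by (cases "lam \<phi>"; auto simp: neg_set_def effective_domain_def)+

text \<open>
  The Gibbs inequality bounds the contribution of $c$, and the Fenchel inequality for $\mu / m(t)$ that
  of $\varphi$. A point of \<open>neg_set lam\<close> ensures that the conjugate of \<open>lam\<close> is not $-\infty$, so that the
  value of \<open>tau_hat\<close> is a real number.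
\<close>

lemma lam_hat_conjugate_le_tau_hat:
  assumes ninf: "\<And>\<phi>. lam \<phi> \<noteq> -\<infinity>" and ne: "neg_set lam \<noteq> {}"
  shows "lam_hat_conjugate lam x \<le> tau_hat lam x"
proof (cases "x \<in> tau_hat_domain lam")
  case False
  then show ?thesis by (cases x) (simp add: tau_hat_def)
next
  case True
  obtain t \<mu> where x: "x = (t, \<mu>)" by (cases x)
  have t: "t \<in> S_tilde" "t \<noteq> e_zero" and fin: "conjugate lam (\<lambda>\<phi>. \<mu> \<phi> / mean t) < \<infinity>"
    using True by (auto simp: x tau_hat_domain_def conjugate_domain_def)
  have m: "mean t > 0" by (rule mean_pos[OF t])
  have ge: "ereal (\<mu> \<phi> / mean t - real_of_ereal (lam \<phi>)) \<le> conjugate lam (\<lambda>\<phi>. \<mu> \<phi> / mean t)"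
    if "\<phi> \<in> effective_domain lam" for \<phi>
  proof -
    have "ereal (real_of_ereal (lam \<phi>)) = lam \<phi>"
      using that ninf[of \<phi>] by (cases "lam \<phi>") (auto simp: effective_domain_def)
    then show ?thesis
      unfolding conjugate_def by (intro SUP_upper2[of \<phi>]) (auto simp flip: ereal_minus(1))
  qed
  obtain \<phi>0 where \<phi>0: "\<phi>0 \<in> neg_set lam" using ne by auto
  obtain k where k: "conjugate lam (\<lambda>\<phi>. \<mu> \<phi> / mean t) = ereal k"
    using fin ge[OF real_of_neg_set(2)[OF ninf \<phi>0]] by (cases "conjugate lam (\<lambda>\<phi>. \<mu> \<phi> / mean t)") auto
  have "(\<Sum>n. c n * t n) + \<mu> \<phi> - ln (\<Sum>n. exp (c n + real n * real_of_ereal (lam \<phi>)))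
      \<le> mean t * k + (\<Sum>n. t n * ln (t n))"
    if c: "c \<in> l_infty" and \<phi>: "\<phi> \<in> neg_set lam" for c \<phi>
  proof -
    have "\<mu> \<phi> / mean t - real_of_ereal (lam \<phi>) \<le> k"
      using ge[OF real_of_neg_set(2)[OF ninf \<phi>]] k by simp
    then have "\<mu> \<phi> \<le> mean t * k + real_of_ereal (lam \<phi>) * mean t"
      using m by (simp add: field_simps)
    then show ?thesis using gibbs_inequality[OF t(1) c real_of_neg_set(1)[OF ninf \<phi>]] by linarith
  qed
  then have "lam_hat_conjugate lam (t, \<mu>) \<le> ereal (mean t * k + (\<Sum>n. t n * ln (t n)))"
    by (simp add: lam_hat_conjugate_le_iff)
  then show ?thesis using True by (simp add: x tau_hat_def k)
qed

lemma dual_linear_combination: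
  assumes "\<mu> \<in> dual" "\<nu> \<in> dual"
  shows "(\<lambda>\<phi>. a * \<mu> \<phi> + b * \<nu> \<phi>) \<in> dual"
  using assms unfolding dual_def
  by (auto intro!: linear_compose_add linear_compose_scale_right[where 'b = real, unfolded real_scaleR_def] continuous_intros)

text \<open>
  The form in which \<open>tau_hat\<close> is bounded above: a bound on all \<open>\<phi>\<close> in the effective domain already
  puts the point into \<open>tau_hat_domain\<close>, so that neither this nor the division by the mean recurs later.
\<close>

lemma tau_hat_le:
  assumes ninf: "\<And>\<phi>. lam \<phi> \<noteq> -\<infinity>" and t: "t \<in> S_tilde" "mean t > 0" and \<mu>: "\<mu> \<in> dual"
    and le: "\<And>\<phi>. \<phi> \<in> effective_domain lam \<Longrightarrow> \<mu> \<phi> - mean t * real_of_ereal (lam \<phi>) \<le> V"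
  shows "tau_hat lam (t, \<mu>) \<le> ereal (V + (\<Sum>n. t n * ln (t n)))"
proof -
  have "ereal (\<mu> \<phi> / mean t) - lam \<phi> \<le> ereal (V / mean t)" for \<phi>
  proof (cases "lam \<phi>")
    case (real l)
    then have "\<mu> \<phi> - mean t * l \<le> V" using le[of \<phi>] by (simp add: effective_domain_def)
    then have "\<mu> \<phi> / mean t \<le> V / mean t + l"
      using t(2) by (simp add: add_divide_distrib pos_divide_le_eq algebra_simps)
    then show ?thesis using real by simp
  qed (use ninf in auto)
  then have conj: "conjugate lam (\<lambda>\<phi>. \<mu> \<phi> / mean t) \<le> ereal (V / mean t)"
    by (simp add: conjugate_def SUP_le_iff)
  moreover have "(\<lambda>\<phi>. \<mu> \<phi> / mean t) \<in> dual"
    using dual_linear_combination[OF \<mu> \<mu>, of "1 / mean t" 0] by simp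
  ultimately have "(t, \<mu>) \<in> tau_hat_domain lam"
    using t \<mu> mean_pos_imp_ne_e_zero[OF t(2)]
    by (auto simp: tau_hat_domain_def conjugate_domain_def S_tilde_in_l_one)
  moreover have "ereal (mean t) * conjugate lam (\<lambda>\<phi>. \<mu> \<phi> / mean t) \<le> ereal (mean t) * ereal (V / mean t)"
    using t(2) by (intro ereal_mult_left_mono conj) auto
  then have "ereal (mean t) * conjugate lam (\<lambda>\<phi>. \<mu> \<phi> / mean t) + ereal (\<Sum>n. t n * ln (t n))
      \<le> ereal V + ereal (\<Sum>n. t n * ln (t n))"
    using t(2) by (intro add_right_mono) simp
  ultimately show ?thesis by (simp add: tau_hat_def)
qed

section \<open>Approximation by points of the entropy functional\<close>

lemma convex_on_effective_domain:
  assumes conv: "convex_functional lam" and ninf: "\<And>\<phi>. lam \<phi> \<noteq> -\<infinity>"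
  shows "convex_on (effective_domain lam) (\<lambda>\<phi>. real_of_ereal (lam \<phi>))"
proof -
  have *: "u *\<^sub>R x + v *\<^sub>R y \<in> effective_domain lam \<and>
      real_of_ereal (lam (u *\<^sub>R x + v *\<^sub>R y)) \<le> u * real_of_ereal (lam x) + v * real_of_ereal (lam y)"
    if xy: "x \<in> effective_domain lam" "y \<in> effective_domain lam" and uv: "0 \<le> u" "0 \<le> v" "u + v = 1" for x y u v
  proof -
    obtain a b where ab: "lam x = ereal a" "lam y = ereal b"
      using xy ninf[of x] ninf[of y] by (cases "lam x"; cases "lam y") (auto simp: effective_domain_def)
    have "lam (u *\<^sub>R x + v *\<^sub>R y) \<le> ereal (u * a + v * b)"
      using conv[unfolded convex_functional_def, rule_format, OF uv, of x y] ab by simp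
    then show ?thesis using ab ninf[of "u *\<^sub>R x + v *\<^sub>R y"]
      by (cases "lam (u *\<^sub>R x + v *\<^sub>R y)") (auto simp: effective_domain_def)
  qed
  then show ?thesis by (auto simp: convex_on_def convex_def)
qed

lemma concave_on_linear_minus_convex:
  assumes \<mu>: "linear \<mu>" and g: "convex_on D g" and m: "m \<ge> 0"
  shows "concave_on D (\<lambda>x. \<mu> x - m * g x - k)"
  unfolding concave_on_iff
proof (intro conjI ballI allI impI)
  show "convex D" by (rule convex_on_imp_convex[OF g])
  fix x y u v assume xy: "x \<in> D" "y \<in> D" "0 \<le> u" "0 \<le> v" "u + v = (1::real)"
  have "g (u *\<^sub>R x + v *\<^sub>R y) \<le> u * g x + v * g y"
    using g xy unfolding convex_on_def by blast
  then have "m * g (u *\<^sub>R x + v *\<^sub>R y) \<le> m * (u * g x + v * g y)"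
    using m by (rule mult_left_mono)
  moreover have "\<mu> (u *\<^sub>R x + v *\<^sub>R y) = u * \<mu> x + v * \<mu> y"
    by (simp add: linear_add[OF \<mu>] linear_cmul[OF \<mu>])
  moreover have "u * k + v * k = k" using xy by (simp flip: distrib_right)
  ultimately show "u * (\<mu> x - m * g x - k) + v * (\<mu> y - m * g y - k)
      \<le> \<mu> (u *\<^sub>R x + v *\<^sub>R y) - m * g (u *\<^sub>R x + v *\<^sub>R y) - k"
    by (simp add: algebra_simps)
qed

lemma limitin_weak_star:
  assumes "\<mu> \<in> dual" "\<And>k. x k \<in> dual" "\<And>\<phi>. ((\<lambda>k. x k \<phi>) \<longlongrightarrow> \<mu> \<phi>) F"
  shows "limitin weak_star_topology x \<mu> F"
  using assms by (simp add: weak_star_topology_def limitin_subtopology limitin_componentwise)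

lemma limitin_l_one:
  assumes t: "t \<in> l_one" "\<And>k. x k \<in> l_one" and lim: "((\<lambda>k. l_one_dist (x k) t) \<longlongrightarrow> 0) F"
  shows "limitin l_one_topology x t F"
proof -
  interpret Metric_space l_one l_one_dist by (rule Metric_space_l_one)
  have "\<forall>\<^sub>F k in F. x k \<in> l_one \<and> l_one_dist (x k) t < e" if "e > 0" for e
    using order_tendstoD(2)[OF lim that] by eventually_elim (use t in auto)
  then show ?thesis
    using t by (simp add: l_one_topology_def limitin_metric)
qed

text \<open>
  The approximating points have means $m(t) + s + \epsilon_k$, with the Lagrange multiplier $s$ of the
  constraint $\lambda < 0$ and $\epsilon_k = 1 / (k + 1)$. The positive $\epsilon_k$ keeps the mean away from $0$ and is
  paid for by adding $\epsilon_k \nu$ to $\mu$, at a cost of at most $\epsilon_k K$.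
\<close>

lemma tau_hat_approximation:
  fixes lam :: "'a::real_lctvs \<Rightarrow> ereal"
  assumes ninf: "\<And>\<phi>. lam \<phi> \<noteq> -\<infinity>" and conv: "convex_functional lam"
    and ne: "neg_set lam \<noteq> {}"
    and \<nu>: "\<nu> \<in> dual" "\<And>\<phi>. \<phi> \<in> effective_domain lam \<Longrightarrow> \<nu> \<phi> - real_of_ereal (lam \<phi>) \<le> K"
    and t: "t \<in> l_one" and \<mu>: "\<mu> \<in> dual" and less: "lam_hat_conjugate lam (t, \<mu>) < ereal a"
  obtains x where "limitin (prod_topology l_one_topology weak_star_topology) x (t, \<mu>) sequentially"
    and "\<forall>\<^sub>F k in sequentially. tau_hat lam (x k) \<le> ereal a"
proof -
  obtain g where g: "lam_hat_conjugate lam (t, \<mu>) \<le> ereal g" "g < a"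
    using ereal_dense3[OF less] by (auto dest: less_imp_le)
  define l where "l = (\<lambda>\<phi>. real_of_ereal (lam \<phi>))"
  have bound: "(\<Sum>n. c n * t n) - ln (\<Sum>n. exp (c n + real n * l \<phi>)) \<le> g - \<mu> \<phi>"
    if "\<phi> \<in> neg_set lam" "c \<in> l_infty" for \<phi> c
    using g(1) that by (fastforce simp: lam_hat_conjugate_le_iff l_def)
  have lneg: "l \<phi> < 0" "\<phi> \<in> effective_domain lam" if "\<phi> \<in> neg_set lam" for \<phi>
    using real_of_neg_set[OF ninf that] by (auto simp: l_def)
  obtain \<phi>0 where \<phi>0: "\<phi>0 \<in> neg_set lam" using ne by auto
  have tS: "t \<in> S_tilde"
    using S_tilde_of_conjugate_bounded[OF t lneg(1)[OF \<phi>0] bound[OF \<phi>0]] .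
  define m where "m = mean t"
  define H where "H = (\<Sum>n. t n * ln (t n))"
  have m: "m \<ge> 0" unfolding m_def by (rule mean_nonneg[OF tS])
  have convl: "convex_on (effective_domain lam) l"
    unfolding l_def by (rule convex_on_effective_domain[OF conv ninf])
  have "\<mu> \<phi> - m * l \<phi> - (g - H) \<le> 0" if "\<phi> \<in> effective_domain lam" "l \<phi> < 0" for \<phi>
  proof -
    have "\<phi> \<in> neg_set lam"
      using that ninf[of \<phi>] by (cases "lam \<phi>") (auto simp: l_def effective_domain_def neg_set_def)
    from entropy_le_of_conjugate_bounded[OF t lneg(1)[OF this] bound[OF this]]
    show ?thesis by (simp add: H_def m_def mult.commute)
  qed
  moreover have "concave_on (effective_domain lam) (\<lambda>\<phi>. \<mu> \<phi> - m * l \<phi> - (g - H))"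
    using \<mu> m by (intro concave_on_linear_minus_convex convl) (auto simp: dual_def)
  ultimately obtain s where s: "s \<ge> 0"
    and mult: "\<And>\<phi>. \<phi> \<in> effective_domain lam \<Longrightarrow> \<mu> \<phi> - m * l \<phi> - (g - H) \<le> s * l \<phi>"
    using lagrange_multiplier_exists[OF convl _ lneg(2,1)[OF \<phi>0 ], of "\<lambda>\<phi>. \<mu> \<phi> - m * l \<phi> - (g - H)"] \<phi>0
    by blast
  \<comment> \<open>Mass \<open>\<delta> k\<close> at index \<open>N0 + k\<close> raises the mean by exactly \<open>s + \<epsilon> k\<close>; the choice of \<open>N0\<close> gives \<open>\<delta> k \<le> 1\<close>.\<close>
  obtain N0 :: nat where N0: "m + s + 1 \<le> N0" using real_arch_simple by blast
  define \<epsilon> where "\<epsilon> k = 1 / (real k + 1)" for k :: nat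
  define \<delta> where "\<delta> k = (s + \<epsilon> k) / (real (N0 + k) - m)" for k :: nat
  have \<epsilon>: "0 < \<epsilon> k" "\<epsilon> k \<le> 1" for k by (auto simp: \<epsilon>_def)
  have gap: "real (N0 + k) - m \<ge> s + 1 + k" for k using N0 by simp
  have gap': "real (N0 + k) - m > 0" for k using gap[of k] s by linarith
  have \<delta>: "0 \<le> \<delta> k" "\<delta> k \<le> 1" for k
    using s \<epsilon>[of k] gap[of k] gap'[of k] by (auto simp: \<delta>_def divide_le_eq_1)
  have \<delta>_le: "\<delta> k \<le> (s + 1) * \<epsilon> k" for k
  proof -
    have "\<delta> k \<le> (s + 1) / (real k + 1)"
      unfolding \<delta>_def using s \<epsilon>[of k] gap[of k] by (intro frac_le) auto
    then show ?thesis by (simp add: \<epsilon>_def)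
  qed
  define p where "p k = mix_point (\<delta> k) (N0 + k) t" for k
  define \<mu>' where "\<mu>' k = (\<lambda>\<phi>. 1 * \<mu> \<phi> + \<epsilon> k * \<nu> \<phi>)" for k
  have pS: "p k \<in> S_tilde" for k unfolding p_def by (rule mix_point_S_tilde(1)[OF tS \<delta>])
  have pmean: "mean (p k) = m + s + \<epsilon> k" for k
  proof -
    have "mean (p k) = m + \<delta> k * (real (N0 + k) - m)"
      unfolding p_def mix_point_S_tilde(2)[OF tS \<delta>] by (simp add: m_def algebra_simps)
    also have "\<delta> k * (real (N0 + k) - m) = s + \<epsilon> k" using gap'[of k] by (simp add: \<delta>_def)
    finally show ?thesis by simp
  qed
  have \<mu>'dual: "\<mu>' k \<in> dual" for k
    unfolding \<mu>'_def by (rule dual_linear_combination[OF \<mu> \<nu>(1)])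
  have \<epsilon>0: "\<epsilon> \<longlonglongrightarrow> 0"
    using LIMSEQ_inverse_real_of_nat by (simp add: \<epsilon>_def[abs_def] inverse_eq_divide add.commute)
  have \<delta>0: "\<delta> \<longlonglongrightarrow> 0"
  proof (rule Lim_null_comparison)
    show "\<forall>\<^sub>F k in sequentially. norm (\<delta> k) \<le> (s + 1) * \<epsilon> k"
      using \<delta> \<delta>_le by simp
    show "(\<lambda>k. (s + 1) * \<epsilon> k) \<longlonglongrightarrow> 0" by (rule tendsto_mult_right_zero[OF \<epsilon>0])
  qed
  have tau_le: "tau_hat lam (p k, \<mu>' k) \<le> ereal (g - H + \<epsilon> k * K + (1 - \<delta> k) * H)" for k
  proof -
    have "tau_hat lam (p k, \<mu>' k) \<le> ereal ((g - H + \<epsilon> k * K) + (\<Sum>n. p k n * ln (p k n)))"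
    proof (rule tau_hat_le[OF ninf pS _ \<mu>'dual])
      show "mean (p k) > 0" using m s \<epsilon>[of k] by (simp add: pmean)
      fix \<phi> assume \<phi>: "\<phi> \<in> effective_domain lam"
      have "\<epsilon> k * (\<nu> \<phi> - l \<phi>) \<le> \<epsilon> k * K"
        using \<nu>(2)[OF \<phi>] \<epsilon>[of k] by (intro mult_left_mono) (auto simp: l_def)
      then show "\<mu>' k \<phi> - mean (p k) * real_of_ereal (lam \<phi>) \<le> g - H + \<epsilon> k * K"
        using mult[OF \<phi>] by (simp add: pmean \<mu>'_def l_def algebra_simps)
    qed
    also have "\<dots> \<le> ereal (g - H + \<epsilon> k * K + (1 - \<delta> k) * H)"
      using mix_point_entropy_le[OF tS \<delta>, of k "N0 + k" ] by (simp add: p_def H_def)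
    finally show ?thesis .
  qed
  show thesis
  proof (rule that[of "\<lambda>k. (p k, \<mu>' k)"])
    have "(\<lambda>k. l_one_dist (p k) t) \<longlonglongrightarrow> 0"
    proof (rule Lim_null_comparison)
      show "\<forall>\<^sub>F k in sequentially. norm (l_one_dist (p k) t) \<le> 2 * \<delta> k"
        using l_one_dist_mix_point_le[OF tS \<delta>] Metric_space.nonneg[OF Metric_space_l_one]
        by (simp add: p_def)
      show "(\<lambda>k. 2 * \<delta> k) \<longlonglongrightarrow> 0" by (rule tendsto_mult_right_zero[OF \<delta>0])
    qed
    then have "limitin l_one_topology p t sequentially"
      by (intro limitin_l_one t S_tilde_in_l_one pS)
    moreover have "(\<lambda>k. \<mu>' k \<phi>) \<longlonglongrightarrow> 1 * \<mu> \<phi> + 0 * \<nu> \<phi>" for \<phi>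
      unfolding \<mu>'_def by (intro tendsto_intros \<epsilon>0)
    then have "limitin weak_star_topology \<mu>' \<mu> sequentially"
      by (intro limitin_weak_star \<mu> \<mu>'dual) simp
    ultimately show "limitin (prod_topology l_one_topology weak_star_topology) (\<lambda>k. (p k, \<mu>' k)) (t, \<mu>) sequentially"
      by (simp add: limitin_pairwise comp_def)
    have "(\<lambda>k. g - H + \<epsilon> k * K + (1 - \<delta> k) * H) \<longlonglongrightarrow> g - H + 0 * K + (1 - 0) * H"
      by (intro tendsto_intros \<epsilon>0 \<delta>0)
    then have "\<forall>\<^sub>F k in sequentially. g - H + \<epsilon> k * K + (1 - \<delta> k) * H < a"
      using g(2) by (intro order_tendstoD(2)) auto
    then show "\<forall>\<^sub>F k in sequentially. tau_hat lam (p k, \<mu>' k) \<le> ereal a"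
      by eventually_elim (rule order_trans[OF tau_le], simp)
  qed
qed

text \<open>
  Semicontinuity of \<open>lam\<close> is replaced by what the approximation needs of it: a continuous linear
  functional $\nu$ such that $\nu - \lambda$ is bounded above.
\<close>

theorem lam_hat_conjugate_is_lsc_regularization:
  fixes lam :: "'a::real_lctvs \<Rightarrow> ereal"
  assumes ninf: "\<And>\<phi>. lam \<phi> \<noteq> -\<infinity>" and conv: "convex_functional lam"
    and ne: "neg_set lam \<noteq> {}"
    and \<nu>: "\<nu> \<in> dual" "\<And>\<phi>. \<phi> \<in> effective_domain lam \<Longrightarrow> \<nu> \<phi> - real_of_ereal (lam \<phi>) \<le> K"
  shows "is_lsc_regularization (prod_topology l_one_topology weak_star_topology)
           (tau_hat lam) (lam_hat_conjugate lam)"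
  unfolding is_lsc_regularization_def
proof (intro conjI allI impI ballI)
  let ?X = "prod_topology l_one_topology weak_star_topology :: ((nat \<Rightarrow> real) \<times> ('a \<Rightarrow> real)) topology"
  show "lower_semicontinuous ?X (lam_hat_conjugate lam)" by (rule lam_hat_conjugate_lsc[OF ne])
  show "lam_hat_conjugate lam x \<le> tau_hat lam x" for x
    by (rule lam_hat_conjugate_le_tau_hat[OF ninf ne])
  fix h x
  assume h: "lower_semicontinuous ?X h \<and> (\<forall>x\<in>topspace ?X. h x \<le> tau_hat lam x)" and x: "x \<in> topspace ?X"
  obtain t \<mu> where x_eq: "x = (t, \<mu>)" and t: "t \<in> l_one" and \<mu>: "\<mu> \<in> dual"
    using x by (cases x) auto
  show "h x \<le> lam_hat_conjugate lam x"
  proof (rule ccontr)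
    assume "\<not> h x \<le> lam_hat_conjugate lam x"
    then obtain a where a: "lam_hat_conjugate lam x < ereal a" "ereal a < h x"
      using ereal_dense3 by (auto simp: not_le)
    obtain y where y: "limitin ?X y (t, \<mu>) sequentially"
      and le: "\<forall>\<^sub>F k in sequentially. tau_hat lam (y k) \<le> ereal a"
      using tau_hat_approximation[OF ninf conv ne \<nu> t \<mu>] a(1) unfolding x_eq by blast
    have "\<forall>\<^sub>F k in sequentially. y k \<in> topspace ?X"
      using y by (simp only: limitin_def) (metis openin_topspace)
    with le have "\<forall>\<^sub>F k in sequentially. y k \<in> {z \<in> topspace ?X. h z \<le> ereal a}"
      by eventually_elim (use h order_trans in blast)
    moreover have "closedin ?X {z \<in> topspace ?X. h z \<le> ereal a}"
      using h unfolding lower_semicontinuous_def by blast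
    ultimately have "(t, \<mu>) \<in> {z \<in> topspace ?X. h z \<le> ereal a}"
      using y by (intro limitin_closedin) auto
    then show False using a(2) by (auto simp: x_eq dest: leD)
  qed
qed

text \<open>
  A lower semicontinuous function that is finite at a point is bounded below near that point. For
  the convex function \<open>lam\<close> this already yields a continuous affine minorant.
\<close>

theorem proposition2p8:
  fixes r lam :: "'a::real_lctvs \<Rightarrow> ereal"
  assumes r_pos: "\<And>\<phi>. 0 < r \<phi>"
    and r_log_convex: "log_convex r"
    and r_lsc: "lower_semicontinuous euclidean r"
    and lam_def: "lam = (\<lambda>\<phi>. ln_ereal (r \<phi>))"
    and D_nonempty: "neg_set lam \<noteq> {}"
  shows "is_lsc_regularization (prod_topology l_one_topology weak_star_topology)
           (tau_hat lam) (lam_hat_conjugate lam)"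
proof -
  have ninf: "lam \<phi> \<noteq> -\<infinity>" for \<phi>
    using r_pos[of \<phi>] by (auto simp: lam_def ln_ereal_def)
  have conv: "convex_functional lam"
    using r_log_convex by (simp add: log_convex_def lam_def)
  have lam_less: "ereal b < lam \<phi> \<longleftrightarrow> ereal (exp b) < r \<phi>" for b \<phi>
    using r_pos[of \<phi>]
    by (cases "r \<phi>") (auto simp: lam_def ln_ereal_def ln_less_cancel_iff[symmetric] simp del: ln_less_cancel_iff)
  obtain \<phi>0 where \<phi>0: "\<phi>0 \<in> neg_set lam" using D_nonempty by auto
  define b where "b = real_of_ereal (lam \<phi>0) - 1"
  define U where "U = {\<phi>. ereal b < lam \<phi>}"
  have "closed {\<phi>. r \<phi> \<le> ereal (exp b)}"
    using r_lsc by (simp add: lower_semicontinuous_def)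
  then have "open (- {\<phi>. r \<phi> \<le> ereal (exp b)})" by (rule open_Compl)
  moreover have "- {\<phi>. r \<phi> \<le> ereal (exp b)} = U"
    by (auto simp: U_def lam_less)
  ultimately have "open U" by simp
  moreover have "\<phi>0 \<in> U"
    using ninf[of \<phi>0] real_of_neg_set(2)[OF ninf \<phi>0]
    by (cases "lam \<phi>0") (auto simp: U_def b_def effective_domain_def)
  moreover have "b \<le> real_of_ereal (lam \<phi>)" if "\<phi> \<in> effective_domain lam" "\<phi> \<in> U" for \<phi>
    using that by (cases "lam \<phi>") (auto simp: U_def effective_domain_def)
  ultimately obtain \<nu> K where "\<nu> \<in> dual" "\<And>\<phi>. \<phi> \<in> effective_domain lam \<Longrightarrow> \<nu> \<phi> - real_of_ereal (lam \<phi>) \<le> K"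
    using continuous_affine_minorant[OF convex_on_effective_domain[OF conv ninf] real_of_neg_set(2)[OF ninf \<phi>0]]
    by metis
  then show ?thesis
    by (intro lam_hat_conjugate_is_lsc_regularization ninf conv D_nonempty)
qed

end
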